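(* Let $d\ge3$ be an integer. There exists a constant $c_d>0$ depending on $d$ only such that for every $n\ge2$ and every $a=(a_1,\dots,a_n)\in\mathbb{R}^n$ with $n^{-1}\sum_{i=1}^na_i^2=1$, the polynomial $Q_{d,a}(\theta)=\sum_{i=1}^na_i\theta_i^d$, $\theta\in S^{n-1}$, satisfies $$\int_{S^{n-1}}\exp\Big(c_d\,n^{(d-1)/d}\,|Q_{d,a}-\bar Q_{d,a}|^{2/d}\Big)\,d\sigma_{n-1}\le 2,$$ where $\bar Q_{d,a}=\int_{S^{n-1}}Q_{d,a}\,d\sigma_{n-1}$. In particular, $Q_{d,a}-\bar Q_{d,a}=\mathcal{O}_{\sigma_{n-1}}\big(n^{-\frac{d-1}2}\big)$.
   Context: $S^{n-1}$ is the unit sphere in $\mathbb{R}^n$ and $\sigma_{n-1}$ the uniform probability measure on it. The notation $\mathcal{O}_{\sigma_{n-1}}(r_n)$ means stochastic boundedness: the quantities divided by $r_n$ are bounded in $\sigma_{n-1}$-probability as $n\to\infty$. *)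

theory Defs
  imports "HOL-Probability.Probability"
begin

text \<open>
  As the dimension \<open>n\<close> is quantified inside the formulas, \<open>\<real>\<^sup>n\<close> is represented by the functions
  in \<open>{1..n} \<rightarrow>\<^sub>E (UNIV :: real set)\<close>, with the Lebesgue measure given by the finite product of
  \<open>lborel\<close> and the Euclidean norm given by \<open>L2_set\<close>.
\<close>

abbreviation lebesgue_Rn :: "nat \<Rightarrow> (nat \<Rightarrow> real) measure" where
  "lebesgue_Rn n \<equiv> PiM {1..n} (\<lambda>_. lborel)"

definition unit_ball_Rn :: "nat \<Rightarrow> (nat \<Rightarrow> real) set" where
  "unit_ball_Rn n = {x \<in> {1..n} \<rightarrow>\<^sub>E UNIV. L2_set x {1..n} \<le> 1}"

definition unit_sphere_Rn :: "nat \<Rightarrow> (nat \<Rightarrow> real) set" where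
  "unit_sphere_Rn n = {x \<in> {1..n} \<rightarrow>\<^sub>E UNIV. L2_set x {1..n} = 1}"

definition radial_proj :: "nat \<Rightarrow> (nat \<Rightarrow> real) \<Rightarrow> (nat \<Rightarrow> real)" where
  "radial_proj n x = (\<lambda>i\<in>{1..n}. x i / L2_set x {1..n})"

text \<open>
  The normalised surface measure of the sphere, as the normalised cone measure: the measure of a
  Borel set \<open>A\<close> of the sphere is \<open>vol {t *\<^sub>R \<theta> | 0 < t \<le> 1, \<theta> \<in> A} / vol (unit ball)\<close>, that is, the
  law of \<open>x / \<parallel>x\<parallel>\<close> for \<open>x\<close> uniform in the unit ball. The restriction only discards the
  image of the origin, a null set, so that the sphere is the space of the measure.
\<close>

definition sphere_unif :: "nat \<Rightarrow> (nat \<Rightarrow> real) measure" where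
  "sphere_unif n =
     restrict_space
       (distr (uniform_measure (lebesgue_Rn n) (unit_ball_Rn n)) (lebesgue_Rn n) (radial_proj n))
       (unit_sphere_Rn n)"

definition Q_poly :: "nat \<Rightarrow> nat \<Rightarrow> (nat \<Rightarrow> real) \<Rightarrow> (nat \<Rightarrow> real) \<Rightarrow> real" where
  "Q_poly n d a \<theta> = (\<Sum>i=1..n. a i * \<theta> i ^ d)"

definition Q_mean :: "nat \<Rightarrow> nat \<Rightarrow> (nat \<Rightarrow> real) \<Rightarrow> real" where
  "Q_mean n d a = (\<integral>\<theta>. Q_poly n d a \<theta> \<partial>sphere_unif n)"

text \<open>Stochastic boundedness of \<open>X n / r n\<close> as \<open>n \<rightarrow> \<infinity>\<close>, each \<open>X n\<close> living on its own space \<open>M n\<close>.\<close>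

definition stoch_bigo ::
  "(nat \<Rightarrow> 'a measure) \<Rightarrow> (nat \<Rightarrow> 'a \<Rightarrow> real) \<Rightarrow> (nat \<Rightarrow> real) \<Rightarrow> bool" where
  "stoch_bigo M X r \<longleftrightarrow>
     (\<forall>\<epsilon>>0. \<exists>K>0. \<forall>\<^sub>F n in sequentially.
        measure (M n) {x \<in> space (M n). \<bar>X n x / r n\<bar> > K} < \<epsilon>)"

lemma space_sphere_unif [simp]: "space (sphere_unif n) = unit_sphere_Rn n"
  by (auto simp: sphere_unif_def space_restrict_space space_PiM unit_sphere_Rn_def)

lemma unit_ball_Rn_eq:
  "unit_ball_Rn n = {f. sqrt (\<Sum>i\<in>{1..n}. (f i)\<^sup>2) \<le> 1} \<inter> space (lebesgue_Rn n)"
  by (auto simp: unit_ball_Rn_def L2_set_def space_PiM)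

lemma emeasure_unit_ball_Rn:
  "emeasure (lebesgue_Rn n) (unit_ball_Rn n) = ennreal (unit_ball_vol (real n))"
  unfolding unit_ball_Rn_eq using emeasure_cball_aux[of "{1..n}" 1] by simp

lemma sets_unit_ball_Rn [measurable]: "unit_ball_Rn n \<in> sets (lebesgue_Rn n)"
proof -
  have "unit_ball_Rn n = {f \<in> space (lebesgue_Rn n). sqrt (\<Sum>i\<in>{1..n}. (f i)\<^sup>2) \<le> 1}"
    by (auto simp: unit_ball_Rn_eq)
  then show ?thesis by simp
qed

lemma sets_unit_sphere_Rn [measurable]: "unit_sphere_Rn n \<in> sets (lebesgue_Rn n)"
proof -
  have "unit_sphere_Rn n = {f \<in> space (lebesgue_Rn n). sqrt (\<Sum>i\<in>{1..n}. (f i)\<^sup>2) = 1}"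
    by (auto simp: unit_sphere_Rn_def L2_set_def space_PiM)
  then show ?thesis by simp
qed

lemma measurable_radial_proj [measurable]:
  "radial_proj n \<in> lebesgue_Rn n \<rightarrow>\<^sub>M lebesgue_Rn n"
proof -
  have "(\<lambda>x. \<lambda>i\<in>{1..n}. x i / sqrt (\<Sum>j\<in>{1..n}. (x j)\<^sup>2)) \<in> lebesgue_Rn n \<rightarrow>\<^sub>M lebesgue_Rn n"
    by (rule measurable_restrict) simp
  then show ?thesis
    by (simp add: radial_proj_def[abs_def] L2_set_def)
qed

lemma radial_proj_in_sphere:
  assumes "L2_set x {1..n} \<noteq> 0"
  shows "radial_proj n x \<in> unit_sphere_Rn n"
proof -
  have "L2_set (radial_proj n x) {1..n} = L2_set (\<lambda>i. inverse (L2_set x {1..n}) * x i) {1..n}"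
    by (intro L2_set_cong) (auto simp: radial_proj_def field_simps)
  also have "\<dots> = inverse (L2_set x {1..n}) * L2_set x {1..n}"
    by (subst L2_set_right_distrib) auto
  finally show ?thesis
    using assms by (auto simp: unit_sphere_Rn_def radial_proj_def)
qed

lemma prob_space_sphere_unif:
  assumes "n \<ge> 1"
  shows "prob_space (sphere_unif n)"
proof -
  note One_nat_def [simp del]
  let ?L = "lebesgue_Rn n" and ?U = "uniform_measure (lebesgue_Rn n) (unit_ball_Rn n)"
  interpret product_sigma_finite "\<lambda>_::nat. lborel :: real measure" by standard
  interpret U: prob_space ?U
    by (rule prob_space_uniform_measure)
       (simp_all add: emeasure_unit_ball_Rn less_imp_neq[symmetric])
  let ?z = "\<lambda>i\<in>{1..n}. 0 :: real"
  have "{?z} = (\<Pi>\<^sub>E i\<in>{1..n}. {0::real})"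
    by (auto simp: PiE_def extensional_def fun_eq_iff)
  moreover have "emeasure ?L (\<Pi>\<^sub>E i\<in>{1..n}. {0::real}) = (\<Prod>i\<in>{1..n}. emeasure lborel {0::real})"
    by (rule emeasure_PiM) auto
  moreover have "(\<Pi>\<^sub>E i\<in>{1..n}. {0::real}) \<in> sets ?L"
    by (rule sets_PiM_I_finite) auto
  ultimately have "{?z} \<in> null_sets ?L"
    using assms by (auto simp: null_sets_def card_gt_0_iff)
  then have "AE x in ?L. x \<notin> {?z}" by (rule AE_not_in)
  then have "AE x in ?L. x \<in> unit_ball_Rn n \<longrightarrow> radial_proj n x \<in> unit_sphere_Rn n"
  proof (rule AE_mp, intro AE_I2 impI)
    fix x assume x: "x \<in> space ?L" "x \<notin> {?z}"
    have "L2_set x {1..n} \<noteq> 0"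
    proof
      assume "L2_set x {1..n} = 0"
      then have "\<forall>i\<in>{1..n}. x i = 0" by (simp add: L2_set_eq_0_iff)
      with x(1) have "x = ?z"
        by (intro extensionalityI[of _ "{1..n}"]) (auto simp: space_PiM PiE_def)
      with x(2) show False by simp
    qed
    then show "radial_proj n x \<in> unit_sphere_Rn n" by (rule radial_proj_in_sphere)
  qed
  then have "AE x in ?U. radial_proj n x \<in> unit_sphere_Rn n"
    by (intro AE_uniform_measureI) auto
  then have AE: "AE y in distr ?U ?L (radial_proj n). y \<in> unit_sphere_Rn n"
    using sets_unit_sphere_Rn[of n] by (subst AE_distr_iff) simp_all
  interpret D: prob_space "distr ?U ?L (radial_proj n)"
    by (rule U.prob_space_distr) simp
  have sub: "unit_sphere_Rn n \<inter> space ?L = unit_sphere_Rn n"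
    using sets.sets_into_space[OF sets_unit_sphere_Rn[of n]] by blast
  have "emeasure (distr ?U ?L (radial_proj n)) (unit_sphere_Rn n) = 1"
    using sets_unit_sphere_Rn[of n] AE by (intro D.emeasure_eq_1_AE) simp_all
  then show ?thesis
    unfolding sphere_unif_def
    using sets_unit_sphere_Rn[of n] sub
    by (intro prob_spaceI, subst emeasure_restrict_space) (simp_all add: space_restrict_space)
qed

end

theory Submission
  imports Defs
begin

text \<open>
  If \<open>g\<close> is a standard Gaussian vector, then \<open>g / \<parallel>g\<parallel>\<close> is uniform on the sphere and independent of
  \<open>\<parallel>g\<parallel>\<close>. Hence, for every constant \<open>c\<close>, the moment of \<open>Q - c\<close> of order \<open>2 j\<close> on the sphere is the
  ratio of the Gaussian moment of \<open>Q(g) - c \<parallel>g\<parallel>\<^sup>d\<close> of that order and of the mean of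
  \<open>\<parallel>g\<parallel>\<close> to the power \<open>2 d j\<close>, which is at least \<open>n\<close> to the power \<open>d j\<close> by Jensen. The Gaussian
  moment is that of a sum of independent centered variables, up to a multiple of the fluctuation of \<open>\<parallel>g\<parallel>\<^sup>d\<close>, and is at most
  \<open>K\<^sup>j (j!)\<^sup>d n\<^sup>j\<close>. So \<open>X\<close>, the centered \<open>Q\<close> scaled by \<open>n\<close> to the power \<open>(d - 1) / 2\<close>, satisfies
  \<open>E X\<^bsup>2j\<^esup> \<le> K\<^sup>j (j!)\<^sup>d\<close>; its \<open>d\<close>-th root cancels the factorials in the expansion of the exponential
  of \<open>c \<bar>X\<bar>\<close> to the power \<open>2 / d\<close>, leaving a geometric series. The case \<open>j = 1\<close> and Chebyshev's
  inequality give stochastic boundedness.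
\<close>

section \<open>Moments of sums of independent variables\<close>

text \<open>A binomial coefficient is at least 1, so with \<open>2 \<le> d\<close> it is at most the
  \<open>d\<close>-th power of its own square root. That power is exactly the factor that completes
  the two factorials to \<open>fact k\<close> under the root.\<close>

lemma binomial_mult_sqrt_fact_power_le:
  assumes "2 \<le> d" "l \<le> k"
  shows "real (k choose l) * (sqrt (fact l) ^ d * sqrt (fact (k - l)) ^ d) \<le> sqrt (fact k) ^ d"
proof -
  let ?b = "sqrt (real (k choose l))"
  have "1 \<le> real (k choose l)" using assms(2) by (simp add: Suc_le_eq)
  then have "?b ^ 2 \<le> ?b ^ d" by (intro power_increasing assms(1)) simp
  then have "real (k choose l) \<le> ?b ^ d" by simp
  then have "real (k choose l) * (sqrt (fact l) ^ d * sqrt (fact (k - l)) ^ d)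
      \<le> ?b ^ d * (sqrt (fact l) ^ d * sqrt (fact (k - l)) ^ d)"
    by (intro mult_right_mono) simp_all
  also have "\<dots> = sqrt (fact l * fact (k - l) * real (k choose l)) ^ d"
    by (simp add: real_sqrt_mult power_mult_distrib mult_ac)
  also have "fact l * fact (k - l) * real (k choose l) = fact k"
    using binomial_fact_lemma[OF assms(2)] by (metis of_nat_fact of_nat_mult)
  finally show ?thesis .
qed

text \<open>Beyond the missing linear term the series is geometric, starts at the square of
  \<open>q\<close> and has ratio at most 1/2, so its tail is at most twice its first term.\<close>

lemma sum_power_gap_le:
  fixes q :: real
  assumes "0 \<le> q" "q \<le> 1/2"
  shows "(\<Sum>l\<le>N. if l = 1 then 0 else q ^ l) \<le> 1 + 2 * q\<^sup>2"
proof -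
  \<comment> \<open>The induction also carries a bound for the tail not yet summed. The start at
    \<open>Suc N\<close> puts the gap at 1 into the base case.\<close>
  have "(\<Sum>l\<le>Suc N. if l = 1 then 0 else q ^ l) + 2 * q ^ (N + 2) \<le> 1 + 2 * q\<^sup>2" for N
  proof (induction N)
    case (Suc N)
    have "2 * q ^ (N + 3) \<le> 1 * q ^ (N + 2)"
      using assms mult_right_mono[of "2 * q" 1 "q ^ (N + 2)"] by (simp add: eval_nat_numeral mult_ac)
    with Suc.IH show ?case by (simp add: eval_nat_numeral)
  qed (simp add: power2_eq_square)
  note * = this
  show ?thesis
  proof (cases N)
    case (Suc n)
    show ?thesis unfolding Suc using *[of n] zero_le_power[OF assms(1), of "n + 2"] by linarith
  qed simp
qed

text \<open>The pairs \<open>(l, k - l)\<close> fill the triangle \<open>i + j \<le> N\<close>, and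
  nonnegativity allows enlarging it to the full square.\<close>

lemma sum_convolution_le:
  fixes f g :: "nat \<Rightarrow> real"
  assumes "\<And>i. 0 \<le> f i" "\<And>i. 0 \<le> g i"
  shows "(\<Sum>k\<le>N. \<Sum>l\<le>k. g l * f (k - l)) \<le> (\<Sum>l\<le>N. g l) * (\<Sum>k\<le>N. f k)"
proof -
  have "(\<Sum>k\<le>N. \<Sum>l\<le>k. g l * f (k - l)) = (\<Sum>(i,j)\<in>{(i,j). i + j \<le> N}. g i * f j)"
    by (rule sum.triangle_reindex_eq[symmetric])
  also have "\<dots> \<le> (\<Sum>(i,j)\<in>{..N} \<times> {..N}. g i * f j)"
    using assms by (intro sum_mono2) auto
  finally show ?thesis
    by (simp add: sum_product sum.cartesian_product)
qed

text \<open>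
  The weights \<open>sqrt (fact k) ^ d\<close> are supermultiplicative against binomial coefficients, so the
  weighted generating function of the moments of a sum of independent variables is bounded by the
  product of those of the summands; centering removes the linear terms.
\<close>

lemma (in prob_space) indep_sum_moment_generating_le:
  fixes Y :: "'i \<Rightarrow> 'a \<Rightarrow> real" and a :: "'i \<Rightarrow> real"
  assumes "finite I" "indep_vars (\<lambda>_. borel) Y I"
    and int: "\<And>i k. i \<in> I \<Longrightarrow> integrable M (\<lambda>x. Y i x ^ k)"
    and mean: "\<And>i. i \<in> I \<Longrightarrow> expectation (Y i) = 0"
    and mom: "\<And>i k. i \<in> I \<Longrightarrow> \<bar>expectation (\<lambda>x. Y i x ^ k)\<bar> \<le> B ^ k * sqrt (fact k) ^ d"
    and "2 \<le> d" "0 \<le> B" "0 \<le> z" "\<And>i. i \<in> I \<Longrightarrow> \<bar>a i\<bar> * B * z \<le> 1/2"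
  shows "(\<forall>k. integrable M (\<lambda>x. (\<Sum>i\<in>I. a i * Y i x) ^ k)) \<and>
     (\<forall>N. (\<Sum>k\<le>N. \<bar>expectation (\<lambda>x. (\<Sum>i\<in>I. a i * Y i x) ^ k)\<bar> / sqrt (fact k) ^ d * z ^ k)
        \<le> (\<Prod>i\<in>I. 1 + 2 * (\<bar>a i\<bar> * B * z)\<^sup>2))"
  using assms(1,2) int mean mom assms(9)
proof (induction I)
  case empty
  have "(\<Sum>k\<le>N. \<bar>expectation (\<lambda>x. 0 ^ k)\<bar> / sqrt (fact k) ^ d * z ^ k) = (\<Sum>k\<in>{0::nat}. 1)" for N :: nat
    by (rule sum.mono_neutral_cong_right) (auto simp: prob_space)
  then show ?case by simp
next
  case (insert i I)
  define S where "S = (\<lambda>x. \<Sum>i\<in>I. a i * Y i x)"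
  define w :: "nat \<Rightarrow> real" where "w = (\<lambda>k. sqrt (fact k) ^ d)"
  have w: "w k > 0" for k by (simp add: w_def)
  have rv [measurable]: "j \<in> insert i I \<Longrightarrow> Y j \<in> borel_measurable M" for j
    using insert.prems(1) by (auto simp: indep_vars_def)
  have ind: "indep_vars (\<lambda>_. borel) Y I"
    using insert.prems(1) by (rule indep_vars_subset) auto
  have IH: "integrable M (\<lambda>x. S x ^ k)"
    "(\<Sum>k\<le>N. \<bar>expectation (\<lambda>x. S x ^ k)\<bar> / w k * z ^ k) \<le> (\<Prod>i\<in>I. 1 + 2 * (\<bar>a i\<bar> * B * z)\<^sup>2)" for k N
    using insert.IH[OF ind] insert.prems unfolding S_def w_def by auto
  have "indep_vars (\<lambda>_. borel) (\<lambda>j. (\<lambda>y. a j * y) \<circ> Y j) (insert i I)"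
    using insert.prems(1) by (rule indep_vars_compose) auto
  then have "indep_vars (\<lambda>_. borel) (\<lambda>j x. a j * Y j x) (insert i I)" by (simp add: comp_def)
  from indep_vars_sum[OF insert.hyps this]
  have iv: "indep_var borel (\<lambda>x. a i * Y i x) borel S" by (simp add: S_def)
  have ivp: "indep_var borel (\<lambda>x. (a i * Y i x) ^ l) borel (\<lambda>x. S x ^ m)" for l m
    using indep_var_compose[OF iv, of "\<lambda>x. x ^ l" borel "\<lambda>x. x ^ m" borel] by (simp add: comp_def)
  have intY: "integrable M (\<lambda>x. (a i * Y i x) ^ l)" for l
    using insert.prems(2)[of i l] by (simp add: power_mult_distrib)
  have intp: "integrable M (\<lambda>x. (a i * Y i x) ^ l * S x ^ m)" for l m
    by (rule indep_var_integrable[OF ivp intY IH(1)])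
  have exp: "(\<Sum>j\<in>insert i I. a j * Y j x) ^ k = (\<Sum>l\<le>k. real (k choose l) * ((a i * Y i x) ^ l * S x ^ (k - l)))"
    for x k using insert.hyps by (simp add: S_def binomial_ring mult_ac)
  have int': "integrable M (\<lambda>x. (\<Sum>j\<in>insert i I. a j * Y j x) ^ k)" for k
    unfolding exp by (intro Bochner_Integration.integrable_sum integrable_mult_right intp)
  define u where "u = (\<lambda>k. \<bar>expectation (\<lambda>x. S x ^ k)\<bar> / w k)"
  define q where "q = \<bar>a i\<bar> * B * z"
  \<comment> \<open>The value 0 at \<open>l = 1\<close> records the centering of the summand. It
    makes the new factor \<open>1 + O(q^2)\<close> instead of \<open>1 + O(q)\<close>, so that the
    product over \<open>I\<close> is governed by the Euclidean norm of \<open>a\<close>.\<close>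
  define g where "g = (\<lambda>l::nat. if l = 1 then 0 else q ^ l)"
  have q: "0 \<le> q" "q \<le> 1/2" using insert.prems(5)[of i] \<open>0 \<le> B\<close> \<open>0 \<le> z\<close> by (auto simp: q_def)
  have g: "0 \<le> g l" for l using q by (simp add: g_def)
  have u: "0 \<le> u l" for l using w[of l] by (simp add: u_def)
  have EY: "\<bar>expectation (\<lambda>x. (a i * Y i x) ^ l)\<bar> * z ^ l \<le> g l * w l" for l
  proof (cases "l = 1")
    case False
    have "\<bar>expectation (\<lambda>x. (a i * Y i x) ^ l)\<bar> * z ^ l
        = (\<bar>a i\<bar> * z) ^ l * \<bar>expectation (\<lambda>x. Y i x ^ l)\<bar>"
      by (simp add: power_mult_distrib abs_mult power_abs mult_ac)
    also have "\<dots> \<le> (\<bar>a i\<bar> * z) ^ l * (B ^ l * w l)"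
      using \<open>0 \<le> z\<close> insert.prems(4)[of i l] by (intro mult_left_mono) (auto simp: w_def)
    finally show ?thesis using False by (simp add: g_def q_def power_mult_distrib mult_ac)
  qed (use insert.prems(3)[of i] in \<open>simp add: g_def\<close>)
  have step: "\<bar>expectation (\<lambda>x. (\<Sum>j\<in>insert i I. a j * Y j x) ^ k)\<bar> / w k * z ^ k
      \<le> (\<Sum>l\<le>k. g l * (u (k - l) * z ^ (k - l)))" for k
  proof -
    have "expectation (\<lambda>x. (\<Sum>j\<in>insert i I. a j * Y j x) ^ k)
        = (\<Sum>l\<le>k. real (k choose l) * (expectation (\<lambda>x. (a i * Y i x) ^ l) * expectation (\<lambda>x. S x ^ (k - l))))"
      unfolding exp
      by (subst Bochner_Integration.integral_sum)
        (auto intro!: sum.cong intp simp: indep_var_lebesgue_integral[OF ivp intY IH(1)])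
    then have "\<bar>expectation (\<lambda>x. (\<Sum>j\<in>insert i I. a j * Y j x) ^ k)\<bar> * z ^ k
      \<le> (\<Sum>l\<le>k. \<bar>real (k choose l) * (expectation (\<lambda>x. (a i * Y i x) ^ l) * expectation (\<lambda>x. S x ^ (k - l)))\<bar>) * z ^ k"
      using \<open>0 \<le> z\<close> by (auto intro!: mult_right_mono sum_abs)
    also have "\<dots> = (\<Sum>l\<le>k. real (k choose l) * (\<bar>expectation (\<lambda>x. (a i * Y i x) ^ l)\<bar> * z ^ l)
        * (\<bar>expectation (\<lambda>x. S x ^ (k - l))\<bar> * z ^ (k - l)))"
      unfolding sum_distrib_right
      by (intro sum.cong refl) (simp add: abs_mult power_add[symmetric] mult_ac)
    also have "\<dots> \<le> (\<Sum>l\<le>k. real (k choose l) * (g l * w l) * ((u (k - l) * w (k - l)) * z ^ (k - l)))"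
      using w \<open>0 \<le> z\<close> u
      by (intro sum_mono mult_mono mult_left_mono EY mult_nonneg_nonneg)
        (auto simp: u_def less_imp_neq[THEN not_sym] g w[THEN less_imp_le])
    also have "\<dots> = (\<Sum>l\<le>k. (real (k choose l) * (w l * w (k - l))) * (g l * (u (k - l) * z ^ (k - l))))"
      by (intro sum.cong refl) (simp add: mult_ac)
    \<comment> \<open>The weights absorb the binomial coefficient; after division by
      \<open>w k\<close> a plain convolution is left.\<close>
    also have "\<dots> \<le> (\<Sum>l\<le>k. w k * (g l * (u (k - l) * z ^ (k - l))))"
      using binomial_mult_sqrt_fact_power_le[OF \<open>2 \<le> d\<close>] \<open>0 \<le> z\<close>
      by (intro sum_mono mult_right_mono mult_nonneg_nonneg g u) (auto simp: w_def)
    also have "\<dots> = w k * (\<Sum>l\<le>k. g l * (u (k - l) * z ^ (k - l)))"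
      by (rule sum_distrib_left[symmetric])
    finally show ?thesis
      using w[of k] by (simp add: pos_divide_le_eq mult_ac)
  qed
  have "(\<Sum>k\<le>N. \<bar>expectation (\<lambda>x. (\<Sum>j\<in>insert i I. a j * Y j x) ^ k)\<bar> / w k * z ^ k)
      \<le> (\<Prod>i\<in>insert i I. 1 + 2 * (\<bar>a i\<bar> * B * z)\<^sup>2)" for N
  proof -
    have "(\<Sum>k\<le>N. \<bar>expectation (\<lambda>x. (\<Sum>j\<in>insert i I. a j * Y j x) ^ k)\<bar> / w k * z ^ k)
        \<le> (\<Sum>k\<le>N. \<Sum>l\<le>k. g l * (u (k - l) * z ^ (k - l)))"
      by (intro sum_mono step)
    also have "\<dots> \<le> (\<Sum>l\<le>N. g l) * (\<Sum>k\<le>N. u k * z ^ k)"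
      using g u \<open>0 \<le> z\<close> by (intro sum_convolution_le) auto
    also have "\<dots> \<le> (1 + 2 * q\<^sup>2) * (\<Prod>i\<in>I. 1 + 2 * (\<bar>a i\<bar> * B * z)\<^sup>2)"
      using sum_power_gap_le[OF q] IH(2)[of N] u \<open>0 \<le> z\<close>
      by (intro mult_mono) (auto simp: g_def u_def w_def intro!: sum_nonneg)
    finally show ?thesis using insert.hyps by (simp add: q_def)
  qed
  with int' show ?case unfolding w_def by blast
qed

text \<open>Every moment is one term of the generating sum with nonnegative terms, so a bounded
  product at one well-chosen \<open>z\<close> bounds all moments at once.\<close>

lemma (in prob_space) indep_sum_moment_le:
  fixes Y :: "'i \<Rightarrow> 'a \<Rightarrow> real" and a :: "'i \<Rightarrow> real"
  assumes I: "finite I" and ind: "indep_vars (\<lambda>_. borel) Y I"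
    and int: "\<And>i k. i \<in> I \<Longrightarrow> integrable M (\<lambda>x. Y i x ^ k)"
    and mean: "\<And>i. i \<in> I \<Longrightarrow> expectation (Y i) = 0"
    and mom: "\<And>i k. i \<in> I \<Longrightarrow> \<bar>expectation (\<lambda>x. Y i x ^ k)\<bar> \<le> B ^ k * sqrt (fact k) ^ d"
    and d: "2 \<le> d" and B: "0 < B" and a: "L2_set a I > 0"
  shows "integrable M (\<lambda>x. (\<Sum>i\<in>I. a i * Y i x) ^ k)"
    and "\<bar>expectation (\<lambda>x. (\<Sum>i\<in>I. a i * Y i x) ^ k)\<bar> \<le> 2 * (2 * B * L2_set a I) ^ k * sqrt (fact k) ^ d"
proof -
  \<comment> \<open>This choice makes each \<open>\<bar>a i\<bar> * B * z\<close> at most 1/2, and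
    the squares of these numbers sum to 1/4. The product is therefore at most
    \<open>exp (1/2)\<close>, which is below 2.\<close>
  define z where "z = 1 / (2 * B * L2_set a I)"
  have z: "0 < z" using B a by (simp add: z_def)
  have Bz: "\<bar>a i\<bar> * B * z = \<bar>a i\<bar> / (2 * L2_set a I)" for i using B by (simp add: z_def)
  have "\<bar>a i\<bar> * B * z \<le> 1/2" if "i \<in> I" for i
  proof -
    have "\<bar>a i\<bar> \<le> L2_set (\<lambda>i. \<bar>a i\<bar>) I" using I that by (intro member_le_L2_set) auto
    then have "\<bar>a i\<bar> \<le> L2_set a I" by (simp add: L2_set_def)
    then show ?thesis unfolding Bz using a by (simp add: field_simps)
  qed
  then have *: "(\<forall>k. integrable M (\<lambda>x. (\<Sum>i\<in>I. a i * Y i x) ^ k)) \<and>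
     (\<forall>N. (\<Sum>k\<le>N. \<bar>expectation (\<lambda>x. (\<Sum>i\<in>I. a i * Y i x) ^ k)\<bar> / sqrt (fact k) ^ d * z ^ k)
        \<le> (\<Prod>i\<in>I. 1 + 2 * (\<bar>a i\<bar> * B * z)\<^sup>2))"
    using B z by (intro indep_sum_moment_generating_le I ind int mean mom d) auto
  then show "integrable M (\<lambda>x. (\<Sum>i\<in>I. a i * Y i x) ^ k)" by auto
  let ?E = "\<lambda>k. \<bar>expectation (\<lambda>x. (\<Sum>i\<in>I. a i * Y i x) ^ k)\<bar>"
  have "?E k / sqrt (fact k) ^ d * z ^ k \<le> (\<Sum>k\<le>k. ?E k / sqrt (fact k) ^ d * z ^ k)"
    using z by (intro member_le_sum) auto
  also have "\<dots> \<le> (\<Prod>i\<in>I. 1 + 2 * (\<bar>a i\<bar> * B * z)\<^sup>2)" using * by blast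
  also have "\<dots> \<le> (\<Prod>i\<in>I. exp (2 * (\<bar>a i\<bar> * B * z)\<^sup>2))"
    by (intro prod_mono) (auto intro!: exp_ge_add_one_self add_nonneg_nonneg)
  also have "\<dots> = exp (2 * (\<Sum>i\<in>I. (\<bar>a i\<bar> / (2 * L2_set a I))\<^sup>2))"
    using I by (simp add: exp_sum Bz sum_distrib_left)
  also have "(\<Sum>i\<in>I. (\<bar>a i\<bar> / (2 * L2_set a I))\<^sup>2) = (L2_set a I)\<^sup>2 / (4 * (L2_set a I)\<^sup>2)"
    by (simp add: power_divide sum_divide_distrib[symmetric] L2_set_def sum_nonneg power_mult_distrib)
  also have "exp (2 * \<dots>) = exp (1/2)" using a by simp
  also have "\<dots> \<le> 2" using exp_half_le2 by simp
  finally have "?E k * z ^ k \<le> 2 * sqrt (fact k) ^ d" by (simp add: field_simps)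
  then show "?E k \<le> 2 * (2 * B * L2_set a I) ^ k * sqrt (fact k) ^ d"
    using B a by (simp add: z_def power_divide field_simps)
qed

section \<open>Polar decomposition of Lebesgue measure\<close>

declare One_nat_def [simp del]

text \<open>Finite products are determined by boxes. On a box the indicator is the product of the
  indicators of its sides, so the integral of the product density factors.\<close>

lemma PiM_density:
  assumes I: "finite I" and "product_sigma_finite M" and "product_sigma_finite (\<lambda>i. density (M i) (f i))"
    and f: "\<And>i. i \<in> I \<Longrightarrow> f i \<in> borel_measurable (M i)"
  shows "PiM I (\<lambda>i. density (M i) (f i)) = density (PiM I M) (\<lambda>x. \<Prod>i\<in>I. f i (x i))"
proof -
  interpret M: product_sigma_finite M by fact
  interpret D: product_sigma_finite "\<lambda>i. density (M i) (f i)" by fact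
  note f[measurable]
  show ?thesis
  proof (rule D.PiM_eqI[OF I, symmetric])
    show "sets (density (PiM I M) (\<lambda>x. \<Prod>i\<in>I. f i (x i))) = sets (PiM I (\<lambda>i. density (M i) (f i)))"
      by (simp cong: sets_PiM_cong)
  next
    fix A assume A: "\<And>i. i \<in> I \<Longrightarrow> A i \<in> sets (density (M i) (f i))"
    then have A': "Pi\<^sub>E I A \<in> sets (PiM I M)" using I by (intro sets_PiM_I_finite) auto
    have "emeasure (density (PiM I M) (\<lambda>x. \<Prod>i\<in>I. f i (x i))) (Pi\<^sub>E I A)
        = (\<integral>\<^sup>+x. (\<Prod>i\<in>I. f i (x i)) * indicator (Pi\<^sub>E I A) x \<partial>PiM I M)"
      using A' by (intro emeasure_density) auto
    also have "\<dots> = (\<integral>\<^sup>+x. (\<Prod>i\<in>I. f i (x i) * indicator (A i) (x i)) \<partial>PiM I M)"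
    proof (intro nn_integral_cong)
      fix x assume "x \<in> space (PiM I M)"
      then have "indicator (Pi\<^sub>E I A) x = (\<Prod>i\<in>I. indicator (A i) (x i) :: ennreal)"
        using I by (auto simp: indicator_def space_PiM PiE_iff prod_zero_iff)
      then show "(\<Prod>i\<in>I. f i (x i)) * indicator (Pi\<^sub>E I A) x = (\<Prod>i\<in>I. f i (x i) * indicator (A i) (x i))"
        by (simp add: prod.distrib)
    qed
    also have "\<dots> = (\<Prod>i\<in>I. \<integral>\<^sup>+y. f i y * indicator (A i) y \<partial>M i)"
      using A by (intro M.product_nn_integral_prod I) auto
    also have "\<dots> = (\<Prod>i\<in>I. emeasure (density (M i) (f i)) (A i))"
      using A by (intro prod.cong refl emeasure_density[symmetric]) auto
    finally show "emeasure (density (PiM I M) (\<lambda>x. \<Prod>i\<in>I. f i (x i))) (Pi\<^sub>E I A)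
      = (\<Prod>i\<in>I. emeasure (density (M i) (f i)) (A i))" .
  qed
qed

text \<open>The change of variables for a homothety: on boxes the Jacobian is a product of
  \<open>n\<close> one-dimensional factors \<open>r\<close>.\<close>

lemma nn_integral_lebesgue_Rn_scale:
  assumes [measurable]: "f \<in> borel_measurable (lebesgue_Rn n)" and r: "0 < r"
  shows "(\<integral>\<^sup>+x. f x \<partial>lebesgue_Rn n) = ennreal (r ^ n) * (\<integral>\<^sup>+x. f (\<lambda>i\<in>{1..n}. r * x i) \<partial>lebesgue_Rn n)"
proof -
  let ?L = "lebesgue_Rn n" and ?s = "\<lambda>x. \<lambda>i\<in>{1..n}. r * x i"
  interpret product_sigma_finite "\<lambda>_::nat. lborel :: real measure" by standard
  have s [measurable]: "?s \<in> ?L \<rightarrow>\<^sub>M ?L" by (intro measurable_restrict) simp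
  have "density (distr ?L ?L ?s) (\<lambda>_. ennreal (r ^ n)) = ?L"
  proof (rule PiM_eqI)
    fix A assume A: "\<And>i. i \<in> {1..n} \<Longrightarrow> A i \<in> sets (lborel :: real measure)"
    then have A' [measurable]: "Pi\<^sub>E {1..n} A \<in> sets ?L" by (intro sets_PiM_I_finite) auto
    have "emeasure (density (distr ?L ?L ?s) (\<lambda>_. ennreal (r ^ n))) (Pi\<^sub>E {1..n} A)
       = ennreal (r ^ n) * emeasure ?L (?s -` Pi\<^sub>E {1..n} A \<inter> space ?L)"
      by (simp add: emeasure_density_const emeasure_distr)
    also have "?s -` Pi\<^sub>E {1..n} A \<inter> space ?L = Pi\<^sub>E {1..n} (\<lambda>i. (\<lambda>x. r * x) -` A i)"
      by (auto simp: space_PiM PiE_iff extensional_def)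
    also have "emeasure ?L \<dots> = (\<Prod>i\<in>{1..n}. emeasure lborel ((\<lambda>x. r * x) -` A i))"
    proof (rule emeasure_PiM)
      fix i assume "i \<in> {1..n}"
      with A have "A i \<in> sets borel" by simp
      then show "(\<lambda>x. r * x) -` A i \<in> sets lborel"
        using measurable_sets[of "\<lambda>x. r * x" borel borel "A i"] by simp
    qed simp
    also have "ennreal (r ^ n) * \<dots> = (\<Prod>i\<in>{1..n}. ennreal r * emeasure lborel ((\<lambda>x. r * x) -` A i))"
      using r by (simp add: prod.distrib ennreal_power)
    also have "\<dots> = (\<Prod>i\<in>{1..n}. emeasure lborel (A i))"
    proof (intro prod.cong refl)
      fix i assume "i \<in> {1..n}"
      then have [measurable]: "A i \<in> sets borel" using A by simp
      have "emeasure lborel (A i) = emeasure (density (distr lborel borel ((*) r)) (\<lambda>_. ennreal \<bar>r\<bar>)) (A i)"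
        using r lborel_distr_mult'[of r] by simp
      also have "\<dots> = ennreal r * emeasure lborel ((\<lambda>x. r * x) -` A i)"
        using r by (simp add: emeasure_density_const emeasure_distr)
      finally show "ennreal r * emeasure lborel ((\<lambda>x. r * x) -` A i) = emeasure lborel (A i)" ..
    qed
    finally show "emeasure (density (distr ?L ?L ?s) (\<lambda>_. ennreal (r ^ n))) (Pi\<^sub>E {1..n} A)
      = (\<Prod>i\<in>{1..n}. emeasure lborel (A i))" .
  qed auto
  then have "(\<integral>\<^sup>+x. f x \<partial>?L) = (\<integral>\<^sup>+x. f x \<partial>density (distr ?L ?L ?s) (\<lambda>_. ennreal (r ^ n)))" by simp
  also have "\<dots> = ennreal (r ^ n) * (\<integral>\<^sup>+x. f (?s x) \<partial>?L)"
    by (simp add: nn_integral_density nn_integral_distr nn_integral_cmult)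
  finally show ?thesis .
qed

lemma measurable_L2_set_lebesgue_Rn [measurable]:
  "(\<lambda>x. L2_set x {1..n}) \<in> borel_measurable (lebesgue_Rn n)"
  unfolding L2_set_def by measurable

lemma L2_set_scale: "0 \<le> r \<Longrightarrow> L2_set (\<lambda>i\<in>{1..n}. r * x i) {1..n} = r * L2_set x {1..n}"
  by (subst L2_set_right_distrib) (auto intro!: L2_set_cong)

lemma radial_proj_scale: "0 < r \<Longrightarrow> radial_proj n (\<lambda>i\<in>{1..n}. r * x i) = radial_proj n x"
  unfolding radial_proj_def by (intro restrict_ext) (simp add: L2_set_scale)

text \<open>The origin lies in the hyperplane where coordinate 1 vanishes, and this hyperplane is a
  null set because one of its sides is a single point.\<close>

lemma AE_lebesgue_Rn_L2_set_pos:
  assumes "1 \<le> n"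
  shows "AE x in lebesgue_Rn n. 0 < L2_set x {1..n}"
proof -
  let ?L = "lebesgue_Rn n" and ?A = "\<lambda>i::nat. if i = 1 then {0::real} else UNIV"
  interpret product_sigma_finite "\<lambda>_::nat. lborel :: real measure" by standard
  have "emeasure ?L (Pi\<^sub>E {1..n} ?A) = (\<Prod>i\<in>{1..n}. emeasure lborel (?A i))"
    by (rule emeasure_PiM) auto
  also have "\<dots> = 0" using assms by (intro prod_zero bexI[of _ 1]) auto
  finally have "Pi\<^sub>E {1..n} ?A \<in> null_sets ?L"
    by (intro null_setsI sets_PiM_I_finite) auto
  then have "AE x in ?L. x \<notin> Pi\<^sub>E {1..n} ?A" by (rule AE_not_in)
  then show ?thesis
  proof (rule AE_mp, intro AE_I2 impI)
    fix x assume x: "x \<in> space ?L" "x \<notin> Pi\<^sub>E {1..n} ?A"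
    then have "x 1 \<noteq> 0" by (auto simp: space_PiM PiE_iff split: if_splits)
    then have "L2_set x {1..n} \<noteq> 0" using assms by (auto simp: L2_set_eq_0_iff)
    then show "0 < L2_set x {1..n}" by (simp add: less_le L2_set_nonneg)
  qed
qed

lemma measurable_sphere_unif:
  assumes "f \<in> measurable (lebesgue_Rn n) N"
  shows "f \<in> measurable (sphere_unif n) N"
  unfolding sphere_unif_def using assms by (intro measurable_restrict_space1) simp

text \<open>The cone measure unfolded. Multiplying by the volume of the ball avoids a quotient in
  \<open>ennreal\<close>; the restriction to the sphere disappears because almost every point
  projects into it.\<close>

lemma nn_integral_sphere_unif:
  assumes n: "1 \<le> n" and [measurable]: "f \<in> borel_measurable (lebesgue_Rn n)"
  shows "(\<integral>\<^sup>+\<theta>. f \<theta> \<partial>sphere_unif n) * emeasure (lebesgue_Rn n) (unit_ball_Rn n)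
    = (\<integral>\<^sup>+x. f (radial_proj n x) * indicator (unit_ball_Rn n) x \<partial>lebesgue_Rn n)"
proof -
  let ?L = "lebesgue_Rn n" and ?B = "unit_ball_Rn n"
  let ?U = "uniform_measure ?L ?B"
  let ?v = "emeasure ?L ?B"
  have v: "?v \<noteq> 0" "?v \<noteq> \<infinity>"
    by (simp_all add: emeasure_unit_ball_Rn less_imp_neq[symmetric])
  have sub: "unit_sphere_Rn n \<inter> space (distr ?U ?L (radial_proj n)) \<in> sets (distr ?U ?L (radial_proj n))"
    using sets_unit_sphere_Rn[of n] sets.Int_space_eq2 by auto
  have "(\<integral>\<^sup>+\<theta>. f \<theta> \<partial>sphere_unif n) = (\<integral>\<^sup>+\<theta>. f \<theta> * indicator (unit_sphere_Rn n) \<theta> \<partial>distr ?U ?L (radial_proj n))"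
    unfolding sphere_unif_def using sub by (rule nn_integral_restrict_space)
  also have "\<dots> = (\<integral>\<^sup>+x. f (radial_proj n x) * indicator (unit_sphere_Rn n) (radial_proj n x) \<partial>?U)"
    by (subst nn_integral_distr) auto
  also have "\<dots> = (\<integral>\<^sup>+x. f (radial_proj n x) * indicator (unit_sphere_Rn n) (radial_proj n x)
      * indicator ?B x \<partial>?L) / ?v"
    by (subst nn_integral_uniform_measure) auto
  also have "(\<integral>\<^sup>+x. f (radial_proj n x) * indicator (unit_sphere_Rn n) (radial_proj n x) * indicator ?B x \<partial>?L)
    = (\<integral>\<^sup>+x. f (radial_proj n x) * indicator ?B x \<partial>?L)"
    using AE_lebesgue_Rn_L2_set_pos[OF n]
    by (intro nn_integral_cong_AE) (auto simp: radial_proj_in_sphere elim!: eventually_mono)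
  finally show ?thesis using v
    by (simp add: ennreal_divide_times ennreal_divide_self less_top)
qed

text \<open>The law of the norm under the density \<open>f (radial_proj n x)\<close> is compared
  with \<open>c\<close> times the law of the norm under Lebesgue measure. By scaling, both give
  \<open>{..r}\<close> the mass \<open>r ^ n * (c * v)\<close> for positive \<open>r\<close>.
  Half-lines generate the Borel sets, and \<open>fin\<close> makes these masses finite, so the two
  measures coincide and \<open>F\<close> has the same integral against both.\<close>

lemma nn_integral_polar:
  assumes n: "1 \<le> n" and f [measurable]: "f \<in> borel_measurable (lebesgue_Rn n)"
    and F [measurable]: "F \<in> borel_measurable borel"
    and fin: "(\<integral>\<^sup>+\<theta>. f \<theta> \<partial>sphere_unif n) < \<infinity>"
  shows "(\<integral>\<^sup>+x. F (L2_set x {1..n}) * f (radial_proj n x) \<partial>lebesgue_Rn n)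
    = (\<integral>\<^sup>+x. F (L2_set x {1..n}) \<partial>lebesgue_Rn n) * (\<integral>\<^sup>+\<theta>. f \<theta> \<partial>sphere_unif n)"
proof -
  let ?L = "lebesgue_Rn n" and ?N = "\<lambda>x. L2_set x {1..n}"
  define c where "c = (\<integral>\<^sup>+\<theta>. f \<theta> \<partial>sphere_unif n)"
  define v where "v = emeasure ?L (unit_ball_Rn n)"
  define P where "P = distr (density ?L (\<lambda>x. f (radial_proj n x))) borel ?N"
  define R where "R = scale_measure c (distr ?L borel ?N)"
  \<comment> \<open>Scaling by \<open>r\<close> carries the unit ball to the ball of radius
    \<open>r\<close> and leaves the radial projection unchanged.\<close>
  have ind: "(\<integral>\<^sup>+x. g (radial_proj n x) * indicator {..r} (?N x) \<partial>?L)
      = ennreal (r ^ n) * (\<integral>\<^sup>+x. g (radial_proj n x) * indicator (unit_ball_Rn n) x \<partial>?L)"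
    if r: "0 < r" and [measurable]: "g \<in> borel_measurable ?L" for r and g :: "_ \<Rightarrow> ennreal"
    using r by (subst nn_integral_lebesgue_Rn_scale[OF _ r])
      (auto simp: L2_set_scale radial_proj_scale unit_ball_Rn_def space_PiM indicator_def
        intro!: nn_integral_cong arg_cong2[where f="(*)"])
  have P_eq: "emeasure P {..r} = (\<integral>\<^sup>+x. f (radial_proj n x) * indicator {..r} (?N x) \<partial>?L)" for r
    unfolding P_def by (subst emeasure_distr)
      (auto simp: emeasure_density indicator_def intro!: nn_integral_cong)
  have R_eq: "emeasure R {..r} = c * (\<integral>\<^sup>+x. 1 * indicator {..r} (?N x) \<partial>?L)" for r
  proof -
    have "emeasure R {..r} = c * emeasure ?L (?N -` {..r} \<inter> space ?L)"
      unfolding R_def by (simp add: emeasure_distr)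
    also have "emeasure ?L (?N -` {..r} \<inter> space ?L) = (\<integral>\<^sup>+x. indicator (?N -` {..r} \<inter> space ?L) x \<partial>?L)"
      by (intro nn_integral_indicator[symmetric]) auto
    also have "\<dots> = (\<integral>\<^sup>+x. 1 * indicator {..r} (?N x) \<partial>?L)"
      by (intro nn_integral_cong) (auto simp: indicator_def)
    finally show ?thesis .
  qed
  have P_pos: "emeasure P {..r} = ennreal (r ^ n) * (c * v)" if "0 < r" for r
    unfolding P_eq using that by (simp add: ind c_def v_def nn_integral_sphere_unif[OF n, symmetric])
  have R_pos: "emeasure R {..r} = ennreal (r ^ n) * (c * v)" if "0 < r" for r
    unfolding R_eq using ind[OF that, of "\<lambda>_. 1"] by (simp add: v_def mult_ac)
  \<comment> \<open>The generator contains all half-lines; those with \<open>r \<le> 0\<close> carry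
    no mass, as the norm is almost everywhere positive.\<close>
  have nonpos: "(\<integral>\<^sup>+x. g x * indicator {..r} (?N x) \<partial>?L) = 0"
    if "r \<le> 0" for r and g :: "_ \<Rightarrow> ennreal"
  proof -
    have "(\<integral>\<^sup>+x. g x * indicator {..r} (?N x) \<partial>?L) = (\<integral>\<^sup>+x. 0 \<partial>?L)"
      using AE_lebesgue_Rn_L2_set_pos[OF n] that
      by (intro nn_integral_cong_AE) (auto elim!: eventually_mono)
    then show ?thesis by simp
  qed
  have "P = R"
  proof (rule measure_eqI_generator_eq[where E="range atMost" and \<Omega>=UNIV and A="\<lambda>i. {..real i}"])
    show "Int_stable (range (atMost :: real \<Rightarrow> _))"
      by (auto simp: Int_stable_def)
    show "sets P = sigma_sets UNIV (range atMost)" "sets R = sigma_sets UNIV (range atMost)"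
      by (simp_all add: P_def R_def borel_eq_atMost)
    show "emeasure P X = emeasure R X" if "X \<in> range atMost" for X
    proof -
      from that obtain r where X: "X = {..r}" by blast
      show ?thesis
        by (cases "0 < r") (simp_all only: X P_pos R_pos, simp only: P_eq R_eq nonpos not_less, simp)
    qed
    show "(\<Union>i. {..real i}) = UNIV" by (auto intro: real_arch_simple)
    show "emeasure P {..real i} \<noteq> \<infinity>" for i
    proof (cases "0 < i")
      case True
      then show ?thesis
        using fin by (simp add: P_pos c_def v_def emeasure_unit_ball_Rn ennreal_mult_eq_top_iff)
    next
      case False
      then show ?thesis by (simp only: P_eq nonpos) (simp add: nonpos)
    qed
  qed auto
  have "(\<integral>\<^sup>+x. F (?N x) * f (radial_proj n x) \<partial>?L) = (\<integral>\<^sup>+y. F y \<partial>P)"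
    unfolding P_def by (simp add: nn_integral_distr nn_integral_density mult.commute)
  also have "\<dots> = c * (\<integral>\<^sup>+x. F (?N x) \<partial>?L)"
    unfolding \<open>P = R\<close> R_def by (simp add: nn_integral_scale_measure nn_integral_distr)
  finally show ?thesis by (simp add: c_def mult.commute)
qed

section \<open>Gaussian moments\<close>

text \<open>By induction, splitting off one block of length \<open>l\<close> at a time: each split
  costs a binomial coefficient of at most \<open>2 ^ (Suc d * l)\<close>, and the accumulated
  exponents stay below \<open>d * d\<close> times \<open>l\<close>. It converts Gaussian moments of
  order \<open>d * l\<close> to the weight \<open>fact l ^ d\<close>.\<close>

lemma fact_mult_le: "fact (d * l) \<le> (2 ^ (d * d)) ^ l * (fact l ^ d :: real)"
proof (induction d)
  case (Suc d)
  have "real (Suc d * l choose l) \<le> 2 ^ (Suc d * l)"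
    using binomial_le_pow2[of "Suc d * l" l] by (metis of_nat_le_iff of_nat_numeral of_nat_power)
  moreover have "fact l * fact (d * l) * real (Suc d * l choose l) = fact (Suc d * l)"
    using binomial_fact_lemma[of l "Suc d * l"]
    by (metis add_diff_cancel_left' le_add1 mult_Suc of_nat_fact of_nat_mult)
  ultimately have "fact (Suc d * l) \<le> fact l * fact (d * l) * (2 ^ (Suc d * l) :: real)"
    by (metis mult_left_mono fact_ge_zero mult_nonneg_nonneg)
  also have "\<dots> \<le> fact l * ((2 ^ (d * d)) ^ l * fact l ^ d) * 2 ^ (Suc d * l)"
    by (intro mult_right_mono mult_left_mono Suc.IH) auto
  also have "\<dots> = 2 ^ ((d * d + Suc d) * l) * fact l ^ Suc d"
    by (simp add: power_mult[symmetric] power_add algebra_simps)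
  also have "\<dots> \<le> 2 ^ (Suc d * Suc d * l) * fact l ^ Suc d"
    by (intro mult_right_mono power_increasing mult_le_mono) auto
  finally show ?case by (simp only: power_mult)
qed simp

text \<open>The central binomial bound, with base 4 in place of the 16 that
  \<open>fact_mult_le\<close> gives for \<open>d = 2\<close>.\<close>

lemma fact_double_le: "fact (2 * l) \<le> 4 ^ l * (fact l ^ 2 :: real)"
proof -
  have "real (2 * l choose l) \<le> 2 ^ (2 * l)"
    using binomial_le_pow2[of "2 * l" l] by (metis of_nat_le_iff of_nat_numeral of_nat_power)
  moreover have "fact l * fact l * real (2 * l choose l) = fact (2 * l)"
    using binomial_fact_lemma[of l "2 * l"]
    by (metis add_diff_cancel_left' le_add1 mult_2 of_nat_fact of_nat_mult)
  ultimately have "fact (2 * l) \<le> fact l * fact l * (2 ^ (2 * l) :: real)"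
    by (metis mult_left_mono fact_ge_zero mult_nonneg_nonneg)
  moreover have "(2 :: real) ^ (2 * l) = 4 ^ l" by (simp add: power_mult)
  ultimately show ?thesis by (simp only: power2_eq_square mult_ac)
qed

interpretation std_normal: prob_space std_normal_distribution
  by (rule prob_space_normal_density) simp

lemma integrable_std_normal_abs_moment [simp]: "integrable std_normal_distribution (\<lambda>x. \<bar>x\<bar> ^ k)"
  using integrable_abs[OF integrable_std_normal_distribution_moment[of k]] by (simp add: power_abs)

text \<open>Nonnegativity of the variance bounds the square of the moment by the moment of order
  \<open>2 * k\<close>, which is even and hence known explicitly. This treats odd and even
  \<open>k\<close> alike.\<close>

lemma std_normal_abs_moment_le: "(\<integral>x. \<bar>x\<bar> ^ k \<partial>std_normal_distribution) \<le> sqrt (2 ^ k * fact k)"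
proof -
  have "(\<integral>x. \<bar>x\<bar> ^ k \<partial>std_normal_distribution)\<^sup>2 \<le> (\<integral>x. (\<bar>x\<bar> ^ k)\<^sup>2 \<partial>std_normal_distribution)"
    using std_normal.variance_positive[of "\<lambda>x. \<bar>x\<bar> ^ k"] std_normal.variance_eq[of "\<lambda>x. \<bar>x\<bar> ^ k"]
    by (simp add: power_mult[symmetric] del: power2_abs)
  also have "\<dots> = fact (2 * k) / (2 ^ k * fact k)"
    using std_normal_distribution_even_moments(1)[of k]
    by (simp add: power_mult[symmetric] mult.commute[of k] power_even_abs)
  also have "\<dots> \<le> 2 ^ k * fact k"
    using fact_double_le[of k]
    by (simp add: pos_divide_le_eq power2_eq_square power_mult_distrib[symmetric] mult_ac)
  finally show ?thesis by (rule real_le_rsqrt)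
qed

abbreviation std_normal_moment :: "nat \<Rightarrow> real" where
  "std_normal_moment d \<equiv> (\<integral>x. x ^ d \<partial>std_normal_distribution)"

lemma integrable_std_normal_centered_power:
  "integrable std_normal_distribution (\<lambda>x. (x ^ d - c) ^ k)"
  unfolding diff_conv_add_uminus binomial_ring
  by (intro Bochner_Integration.integrable_sum integrable_mult_left integrable_mult_right)
    (simp add: power_mult[symmetric] integrable_std_normal_distribution_moment)

text \<open>The \<open>l\<close>-th moment of the \<open>d\<close>-th power is a Gaussian moment of
  order \<open>d * l\<close>, of size about the root of \<open>fact (d * l)\<close>, hence at most
  geometric in \<open>l\<close> times \<open>sqrt (fact l) ^ d\<close>. Centering only enlarges the
  base.\<close>

lemma std_normal_centered_power_moment_le:
  "\<exists>B>0. \<forall>l. \<bar>\<integral>x. (x ^ d - std_normal_moment d) ^ l \<partial>std_normal_distribution\<bar> \<le> B ^ l * sqrt (fact l) ^ d"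
proof (intro exI conjI allI)
  define m where "m = std_normal_moment d"
  \<comment> \<open>The exponent \<open>d\<close> comes from
    \<open>std_normal_abs_moment_le\<close>, the exponent \<open>d * d\<close> from
    \<open>fact_mult_le\<close>.\<close>
  define b where "b = sqrt (2 ^ (d + d * d))"
  have b: "0 < b" by (simp add: b_def)
  \<comment> \<open>One factor 2 separates the power from its mean; the other merges the two
    resulting \<open>l\<close>-th powers into one.\<close>
  show "0 < 4 * (b + \<bar>m\<bar>)" using b by simp
  fix l
  have w: "1 \<le> sqrt (fact l) ^ d" by (intro one_le_power) (simp add: fact_ge_1)
  \<comment> \<open>Merging the two powers costs a factor 2, which is at most \<open>2 ^ l\<close>
    only for positive \<open>l\<close>; hence the separate case \<open>l = 0\<close>.\<close>
  show "\<bar>\<integral>x. (x ^ d - std_normal_moment d) ^ l \<partial>std_normal_distribution\<bar> \<le> (4 * (b + \<bar>m\<bar>)) ^ l * sqrt (fact l) ^ d"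
  proof (cases "l = 0")
    case True
    then show ?thesis using std_normal.prob_space by simp
  next
    case False
    have *: "\<bar>x ^ d - m\<bar> ^ l \<le> 2 ^ l * (\<bar>x\<bar> ^ (d * l) + \<bar>m\<bar> ^ l)" for x
    proof -
      have "\<bar>x ^ d - m\<bar> ^ l \<le> (2 * max (\<bar>x\<bar> ^ d) \<bar>m\<bar>) ^ l"
        using abs_triangle_ineq4[of "x ^ d" m] by (intro power_mono) (auto simp: power_abs)
      also have "\<dots> \<le> 2 ^ l * (\<bar>x\<bar> ^ (d * l) + \<bar>m\<bar> ^ l)"
        by (auto simp: power_mult_distrib power_mult max_def)
      finally show ?thesis .
    qed
    have "\<bar>\<integral>x. (x ^ d - m) ^ l \<partial>std_normal_distribution\<bar> \<le> (\<integral>x. \<bar>(x ^ d - m) ^ l\<bar> \<partial>std_normal_distribution)"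
      by (rule integral_abs_bound)
    also have "\<dots> \<le> (\<integral>x. 2 ^ l * (\<bar>x\<bar> ^ (d * l) + \<bar>m\<bar> ^ l) \<partial>std_normal_distribution)"
      using * by (intro integral_mono integrable_abs integrable_std_normal_centered_power) (auto simp: power_abs)
    also have "\<dots> = 2 ^ l * ((\<integral>x. \<bar>x\<bar> ^ (d * l) \<partial>std_normal_distribution) + \<bar>m\<bar> ^ l)"
      using std_normal.prob_space by simp
    also have "(\<integral>x. \<bar>x\<bar> ^ (d * l) \<partial>std_normal_distribution) \<le> sqrt (2 ^ (d * l) * fact (d * l))"
      by (rule std_normal_abs_moment_le)
    also have "\<dots> \<le> sqrt (2 ^ (d * l) * ((2 ^ (d * d)) ^ l * fact l ^ d))"
      by (intro real_sqrt_le_mono mult_left_mono fact_mult_le) simp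
    also have "\<dots> = b ^ l * sqrt (fact l) ^ d"
      by (simp add: b_def real_sqrt_mult real_sqrt_power power_mult power_add power_mult_distrib)
    also have "\<bar>m\<bar> ^ l \<le> \<bar>m\<bar> ^ l * sqrt (fact l) ^ d" using w by (simp add: mult_le_cancel_left1)
    also have "2 ^ l * (b ^ l * sqrt (fact l) ^ d + \<bar>m\<bar> ^ l * sqrt (fact l) ^ d)
      = 2 ^ l * (b ^ l + \<bar>m\<bar> ^ l) * sqrt (fact l) ^ d" by (simp add: algebra_simps)
    also have "\<dots> \<le> 2 ^ l * (2 ^ l * (b + \<bar>m\<bar>) ^ l) * sqrt (fact l) ^ d"
    proof (intro mult_right_mono mult_left_mono)
      have "b ^ l + \<bar>m\<bar> ^ l \<le> (b + \<bar>m\<bar>) ^ l + (b + \<bar>m\<bar>) ^ l"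
        using b by (intro add_mono power_mono) auto
      also have "\<dots> \<le> 2 ^ l * (b + \<bar>m\<bar>) ^ l"
        using b False by (auto simp: mult_2[symmetric] intro!: mult_right_mono self_le_power)
      finally show "b ^ l + \<bar>m\<bar> ^ l \<le> 2 ^ l * (b + \<bar>m\<bar>) ^ l" .
    qed auto
    also have "\<dots> = (4 * (b + \<bar>m\<bar>)) ^ l * sqrt (fact l) ^ d"
      by (simp add: power_mult_distrib[symmetric] mult.assoc[symmetric])
    finally show ?thesis by (simp add: m_def)
  qed
qed

section \<open>The standard Gaussian vector: independent coordinates, power sums and polar
  form\<close>

abbreviation gauss_Rn :: "nat \<Rightarrow> (nat \<Rightarrow> real) measure" where
  "gauss_Rn n \<equiv> PiM {1..n} (\<lambda>_. std_normal_distribution)"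

interpretation gauss: prob_space "gauss_Rn n" for n
  by (rule prob_space_PiM) (rule std_normal.prob_space_axioms)

lemma gauss_Rn_component:
  assumes "i \<in> {1..n}"
  shows "distr (gauss_Rn n) borel (\<lambda>x. x i) = std_normal_distribution"
proof -
  have "distr (gauss_Rn n) borel (\<lambda>x. x i) = distr (gauss_Rn n) std_normal_distribution (\<lambda>x. x i)"
    by (rule distr_cong) auto
  also have "\<dots> = std_normal_distribution"
    by (rule distr_PiM_component[OF std_normal.prob_space_axioms assms])
  finally show ?thesis .
qed

lemma sets_gauss_Rn [measurable_cong]: "sets (gauss_Rn n) = sets (lebesgue_Rn n)"
  by (intro sets_PiM_cong) auto

lemma
  assumes i: "i \<in> {1..n}" and [measurable]: "f \<in> borel_measurable borel"
  shows integrable_gauss_Rn_component: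
      "integrable (gauss_Rn n) (\<lambda>x. f (x i) :: real) \<longleftrightarrow> integrable std_normal_distribution f"
    and integral_gauss_Rn_component:
      "(\<integral>x. f (x i) \<partial>gauss_Rn n) = (\<integral>x. f x \<partial>std_normal_distribution)"
proof -
  have [measurable]: "(\<lambda>x. x i) \<in> borel_measurable (gauss_Rn n)" using i by measurable
  show "integrable (gauss_Rn n) (\<lambda>x. f (x i) :: real) \<longleftrightarrow> integrable std_normal_distribution f"
    using integrable_distr_eq[of "\<lambda>x. x i" "gauss_Rn n" borel f] by (simp add: gauss_Rn_component[OF i])
  show "(\<integral>x. f (x i) \<partial>gauss_Rn n) = (\<integral>x. f x \<partial>std_normal_distribution)"
    using integral_distr[of "\<lambda>x. x i" "gauss_Rn n" borel f] by (simp add: gauss_Rn_component[OF i])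
qed

text \<open>The tuple of coordinates is the identity on extensional functions, so its law is the
  product of the coordinate laws.\<close>

lemma indep_vars_gauss_Rn:
  assumes n: "1 \<le> n"
  shows "gauss.indep_vars n (\<lambda>_. borel) (\<lambda>i x. x i) {1..n}"
proof (subst gauss.indep_vars_iff_distr_eq_PiM')
  have "distr (gauss_Rn n) (lebesgue_Rn n) (\<lambda>x. \<lambda>i\<in>{1..n}. x i) = distr (gauss_Rn n) (gauss_Rn n) (\<lambda>x. x)"
    by (rule distr_cong)
      (auto simp: space_PiM PiE_iff extensional_def fun_eq_iff intro!: sets_PiM_cong)
  also have "\<dots> = gauss_Rn n" by (rule distr_id)
  also have "distr (gauss_Rn n) (lebesgue_Rn n) (\<lambda>x. \<lambda>i\<in>{1..n}. x i)
    = distr (gauss_Rn n) (PiM {1..n} (\<lambda>_. borel)) (\<lambda>x. \<lambda>i\<in>{1..n}. x i)"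
    by (rule distr_cong) (auto intro!: sets_PiM_cong)
  also have "gauss_Rn n = PiM {1..n} (\<lambda>i. distr (gauss_Rn n) borel (\<lambda>x. x i))"
    by (intro PiM_cong refl) (simp add: gauss_Rn_component)
  finally show "distr (gauss_Rn n) (PiM {1..n} (\<lambda>_. borel)) (\<lambda>x. \<lambda>i\<in>{1..n}. x i)
      = PiM {1..n} (\<lambda>i. distr (gauss_Rn n) borel (\<lambda>x. x i))" .
qed (use n in auto)

text \<open>The centered powers of the coordinates are independent with a common moment bound.
  \<open>B\<close> is fixed before \<open>n\<close> and \<open>a\<close>, which is the source of a
  final constant depending on \<open>d\<close> only.\<close>

lemma gauss_Rn_power_sum_moment_le:
  assumes "2 \<le> d"
  shows "\<exists>B>0. \<forall>n\<ge>1. \<forall>a. L2_set a {1..n} > 0 \<longrightarrow> (\<forall>k.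
     integrable (gauss_Rn n) (\<lambda>x. (\<Sum>i\<in>{1..n}. a i * (x i ^ d - std_normal_moment d)) ^ k) \<and>
     \<bar>\<integral>x. (\<Sum>i\<in>{1..n}. a i * (x i ^ d - std_normal_moment d)) ^ k \<partial>gauss_Rn n\<bar>
       \<le> 2 * (2 * B * L2_set a {1..n}) ^ k * sqrt (fact k) ^ d)"
proof -
  obtain B where B: "B > 0" and mom: "\<And>l. \<bar>\<integral>x. (x ^ d - std_normal_moment d) ^ l \<partial>std_normal_distribution\<bar>
      \<le> B ^ l * sqrt (fact l) ^ d"
    using std_normal_centered_power_moment_le[of d] by blast
  show ?thesis
  proof (rule exI[of _ B], intro conjI B allI impI)
    fix n :: nat and a :: "nat \<Rightarrow> real" and k
    assume n: "1 \<le> n" and a: "L2_set a {1..n} > 0"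
    let ?Y = "\<lambda>i x. x i ^ d - std_normal_moment d"
    have "gauss.indep_vars n (\<lambda>_. borel) (\<lambda>i. (\<lambda>y. y ^ d - std_normal_moment d) \<circ> (\<lambda>x. x i)) {1..n}"
      using indep_vars_gauss_Rn[OF n] by (rule gauss.indep_vars_compose) auto
    then have ind: "gauss.indep_vars n (\<lambda>_. borel) ?Y {1..n}" by (simp add: comp_def)
    have int: "integrable (gauss_Rn n) (\<lambda>x. ?Y i x ^ l)" if "i \<in> {1..n}" for i l
      using that integrable_std_normal_centered_power
      by (subst integrable_gauss_Rn_component[where f="\<lambda>y. (y ^ d - std_normal_moment d) ^ l"]) auto
    have eq: "(\<integral>x. ?Y i x ^ l \<partial>gauss_Rn n) = (\<integral>x. (x ^ d - std_normal_moment d) ^ l \<partial>std_normal_distribution)"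
      if "i \<in> {1..n}" for i l
      using that by (subst integral_gauss_Rn_component[where f="\<lambda>y. (y ^ d - std_normal_moment d) ^ l"]) auto
    have mean: "(\<integral>x. ?Y i x \<partial>gauss_Rn n) = 0" if "i \<in> {1..n}" for i
      using eq[OF that, of 1] std_normal.prob_space
      by (simp add: integrable_std_normal_distribution_moment)
    have mom': "\<bar>\<integral>x. ?Y i x ^ l \<partial>gauss_Rn n\<bar> \<le> B ^ l * sqrt (fact l) ^ d" if "i \<in> {1..n}" for i l
      unfolding eq[OF that] by (rule mom)
    show "integrable (gauss_Rn n) (\<lambda>x. (\<Sum>i\<in>{1..n}. a i * ?Y i x) ^ k)"
      by (rule gauss.indep_sum_moment_le(1)[OF _ ind int mean mom' assms B a]) auto
    show "\<bar>\<integral>x. (\<Sum>i\<in>{1..n}. a i * ?Y i x) ^ k \<partial>gauss_Rn n\<bar> \<le> 2 * (2 * B * L2_set a {1..n}) ^ k * sqrt (fact k) ^ d"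
      by (rule gauss.indep_sum_moment_le(2)[OF _ ind int mean mom' assms B a]) auto
  qed
qed

text \<open>The product density depends on the norm alone, which is what opens the way to polar
  integration.\<close>

lemma gauss_Rn_eq_density:
  "gauss_Rn n = density (lebesgue_Rn n)
     (\<lambda>x. ennreal ((1 / sqrt (2 * pi)) ^ n * exp (- (L2_set x {1..n})\<^sup>2 / 2)))"
proof -
  have "gauss_Rn n = density (lebesgue_Rn n) (\<lambda>x. \<Prod>i\<in>{1..n}. ennreal (std_normal_density (x i)))"
    by (rule PiM_density)
      (auto intro!: product_sigma_finite.intro sigma_finite_lborel std_normal.sigma_finite_measure_axioms)
  also have "(\<lambda>x. \<Prod>i\<in>{1..n}. ennreal (std_normal_density (x i)))
      = (\<lambda>x. ennreal ((1 / sqrt (2 * pi)) ^ n * exp (- (L2_set x {1..n})\<^sup>2 / 2)))"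
  proof
    fix x :: "nat \<Rightarrow> real"
    have "(\<Prod>i\<in>{1..n}. ennreal (std_normal_density (x i))) = ennreal (\<Prod>i\<in>{1..n}. std_normal_density (x i))"
      by (intro prod_ennreal) simp
    also have "(\<Prod>i\<in>{1..n}. std_normal_density (x i)) = (1 / sqrt (2 * pi)) ^ n * (\<Prod>i\<in>{1..n}. exp (- (x i)\<^sup>2 / 2))"
      by (simp add: std_normal_density_def prod_dividef power_divide)
    also have "(\<Prod>i\<in>{1..n}. exp (- (x i)\<^sup>2 / 2)) = exp (- (L2_set x {1..n})\<^sup>2 / 2)"
      by (simp add: exp_sum[symmetric] L2_set_def sum_nonneg sum_negf sum_divide_distrib)
    finally show "(\<Prod>i\<in>{1..n}. ennreal (std_normal_density (x i)))
      = ennreal ((1 / sqrt (2 * pi)) ^ n * exp (- (L2_set x {1..n})\<^sup>2 / 2))" .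
  qed
  finally show ?thesis .
qed

text \<open>This is the independence of norm and direction: the radial Gaussian density is absorbed
  into the radial factor of \<open>nn_integral_polar\<close>.\<close>

lemma nn_integral_gauss_Rn_polar:
  assumes n: "1 \<le> n" and [measurable]: "f \<in> borel_measurable (lebesgue_Rn n)" "F \<in> borel_measurable borel"
    and fin: "(\<integral>\<^sup>+\<theta>. f \<theta> \<partial>sphere_unif n) < \<infinity>"
  shows "(\<integral>\<^sup>+x. F (L2_set x {1..n}) * f (radial_proj n x) \<partial>gauss_Rn n)
    = (\<integral>\<^sup>+x. F (L2_set x {1..n}) \<partial>gauss_Rn n) * (\<integral>\<^sup>+\<theta>. f \<theta> \<partial>sphere_unif n)"
proof -
  define G where "G = (\<lambda>r. ennreal ((1 / sqrt (2 * pi)) ^ n * exp (- r\<^sup>2 / 2)))"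
  have [measurable]: "G \<in> borel_measurable borel" by (simp add: G_def)
  have D: "gauss_Rn n = density (lebesgue_Rn n) (\<lambda>x. G (L2_set x {1..n}))"
    unfolding G_def by (rule gauss_Rn_eq_density)
  show ?thesis
    using nn_integral_polar[OF n assms(2) _ fin, of "\<lambda>r. G r * F r"]
    unfolding D by (simp add: nn_integral_density mult.assoc)
qed

lemma power_add_power_le:
  fixes u v :: real
  assumes "0 \<le> u" "0 \<le> v"
  shows "u ^ j + v ^ j \<le> 2 * (u + v) ^ j"
  using assms power_mono[of u "u + v" j] power_mono[of v "u + v" j] by simp

text \<open>Follows from \<open>\<bar>u + v\<bar> \<le> 2 * max \<bar>u\<bar> \<bar>v\<bar>\<close>,
  the power of the maximum being one of the two powers.\<close>

lemma add_power_even_le: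
  fixes u v :: real
  shows "(u + v) ^ (2 * j) \<le> 4 ^ j * (u ^ (2 * j) + v ^ (2 * j))"
proof -
  have "(u + v) ^ (2 * j) = \<bar>u + v\<bar> ^ (2 * j)" by (simp add: power_even_abs)
  also have "\<dots> \<le> (2 * max \<bar>u\<bar> \<bar>v\<bar>) ^ (2 * j)" by (intro power_mono) auto
  also have "\<dots> = 4 ^ j * max \<bar>u\<bar> \<bar>v\<bar> ^ (2 * j)" by (simp add: power_mult_distrib power_mult)
  also have "max \<bar>u\<bar> \<bar>v\<bar> ^ (2 * j) \<le> u ^ (2 * j) + v ^ (2 * j)"
    by (auto simp: max_def power_even_abs zero_le_even_power)
  finally show ?thesis by simp
qed

text \<open>Used to absorb numerical factors into a constant of the form \<open>K ^ j\<close>; this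
  is where moments of order \<open>j \<ge> 1\<close> are singled out.\<close>

lemma two_mult_power_le: "1 \<le> j \<Longrightarrow> 0 \<le> u \<Longrightarrow> 2 * u ^ j \<le> (2 * u) ^ j" for u :: real
  by (auto simp: power_mult_distrib intro!: mult_right_mono self_le_power)

text \<open>The constant term of the binomial expansion cancels. Each remaining power of
  \<open>\<bar>y\<bar>\<close> is at most the first one when \<open>\<bar>y\<bar> \<le> 1\<close>
  and at most the \<open>e\<close>-th one otherwise; the coefficients add up to at most
  \<open>2 ^ e\<close>.\<close>

lemma abs_one_plus_power_diff_le:
  fixes y :: real
  assumes "1 \<le> e"
  shows "\<bar>1 - (1 + y) ^ e\<bar> \<le> 2 ^ e * (\<bar>y\<bar> + \<bar>y\<bar> ^ e)"
proof -
  have "(1 + y) ^ e = (\<Sum>i\<le>e. real (e choose i) * y ^ i)"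
    using binomial_ring[of y 1 e] by (simp add: add.commute)
  also have "\<dots> = 1 + (\<Sum>i\<in>{1..e}. real (e choose i) * y ^ i)"
    by (simp add: atMost_atLeast0 sum.atLeast_Suc_atMost One_nat_def)
  finally have "\<bar>1 - (1 + y) ^ e\<bar> = \<bar>\<Sum>i\<in>{1..e}. real (e choose i) * y ^ i\<bar>" by simp
  also have "\<dots> \<le> (\<Sum>i\<in>{1..e}. \<bar>real (e choose i) * y ^ i\<bar>)" by (rule sum_abs)
  also have "\<dots> \<le> (\<Sum>i\<in>{1..e}. real (e choose i) * (\<bar>y\<bar> + \<bar>y\<bar> ^ e))"
  proof (intro sum_mono)
    fix i assume i: "i \<in> {1..e}"
    have "\<bar>y\<bar> ^ i \<le> \<bar>y\<bar> + \<bar>y\<bar> ^ e"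
    proof (cases "\<bar>y\<bar> \<le> 1")
      case True
      then have "\<bar>y\<bar> ^ i \<le> \<bar>y\<bar> ^ 1" using i by (intro power_decreasing) auto
      then show ?thesis by (simp add: add_increasing2)
    next
      case False
      then have "\<bar>y\<bar> ^ i \<le> \<bar>y\<bar> ^ e" using i by (intro power_increasing) auto
      then show ?thesis by simp
    qed
    then show "\<bar>real (e choose i) * y ^ i\<bar> \<le> real (e choose i) * (\<bar>y\<bar> + \<bar>y\<bar> ^ e)"
      by (simp add: abs_mult power_abs mult_left_mono)
  qed
  also have "\<dots> \<le> (\<Sum>i\<le>e. real (e choose i)) * (\<bar>y\<bar> + \<bar>y\<bar> ^ e)"
    unfolding sum_distrib_right[symmetric] by (intro mult_right_mono sum_mono2) auto
  also have "(\<Sum>i\<le>e. real (e choose i)) = 2 ^ e"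
    using choose_row_sum[of e] by (metis of_nat_numeral of_nat_power of_nat_sum)
  finally show ?thesis .
qed

lemma gauss_Rn_power_sum_even_moment_le:
  assumes "2 \<le> d"
  shows "\<exists>K>0. \<forall>n\<ge>1. \<forall>a. (\<Sum>i=1..n. (a i)\<^sup>2) = real n \<longrightarrow> (\<forall>j\<ge>1.
     integrable (gauss_Rn n) (\<lambda>x. (\<Sum>i\<in>{1..n}. a i * (x i ^ d - std_normal_moment d)) ^ (2 * j)) \<and>
     (\<integral>x. (\<Sum>i\<in>{1..n}. a i * (x i ^ d - std_normal_moment d)) ^ (2 * j) \<partial>gauss_Rn n)
       \<le> K ^ j * fact j ^ d * real n ^ j)"
proof -
  obtain B where B: "B > 0" and *: "\<And>n a k. n \<ge> 1 \<Longrightarrow> L2_set a {1..n} > 0 \<Longrightarrow>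
     integrable (gauss_Rn n) (\<lambda>x. (\<Sum>i\<in>{1..n}. a i * (x i ^ d - std_normal_moment d)) ^ k) \<and>
     \<bar>\<integral>x. (\<Sum>i\<in>{1..n}. a i * (x i ^ d - std_normal_moment d)) ^ k \<partial>gauss_Rn n\<bar>
       \<le> 2 * (2 * B * L2_set a {1..n}) ^ k * sqrt (fact k) ^ d"
    using gauss_Rn_power_sum_moment_le[OF assms] by blast
  show ?thesis
  proof (rule exI[of _ "2 * (4 * B\<^sup>2 * 2 ^ d)"], intro conjI allI impI)
    \<comment> \<open>The factor \<open>4 * B^2\<close> comes from \<open>2 * B\<close> to the power
      \<open>2 * j\<close>, the factor \<open>2 ^ d\<close> from the root of
      \<open>fact (2 * j)\<close>, and the leading 2 is absorbed into the \<open>j\<close>-th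
      power.\<close>
    show "0 < 2 * (4 * B\<^sup>2 * 2 ^ d)" using B by simp
    fix n a and j :: nat assume n: "1 \<le> n" and a: "(\<Sum>i=1..n. (a i)\<^sup>2) = real n" and j: "1 \<le> j"
    let ?S = "\<lambda>x. \<Sum>i\<in>{1..n}. a i * (x i ^ d - std_normal_moment d)"
    have L: "L2_set a {1..n} = sqrt (real n)" by (simp add: L2_set_def a)
    note ** = *[OF n, of a "2 * j"]
    show "integrable (gauss_Rn n) (\<lambda>x. ?S x ^ (2 * j))" using ** n by (simp add: L)
    have "(2 ^ j)\<^sup>2 = (4 ^ j :: real)" by (simp add: power2_eq_square flip: power_mult_distrib)
    then have "sqrt (fact (2 * j)) \<le> sqrt ((2 ^ j * fact j)\<^sup>2)"
      using fact_double_le[of j] by (intro real_sqrt_le_mono) (simp add: power_mult_distrib)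
    then have f: "sqrt (fact (2 * j)) \<le> 2 ^ j * fact j" by simp
    have "(\<integral>x. ?S x ^ (2 * j) \<partial>gauss_Rn n) \<le> 2 * (2 * B * sqrt (real n)) ^ (2 * j) * sqrt (fact (2 * j)) ^ d"
      using ** n by (simp add: L)
    also have "\<dots> \<le> 2 * (2 * B * sqrt (real n)) ^ (2 * j) * (2 ^ j * fact j) ^ d"
      using B f by (intro mult_left_mono power_mono) auto
    also have "\<dots> = 2 * (4 * B\<^sup>2 * 2 ^ d) ^ j * fact j ^ d * real n ^ j"
      by (simp add: power_mult_distrib power_mult power_mult[of 2 j d, symmetric] mult.commute[of j d])
    also have "\<dots> \<le> (2 * (4 * B\<^sup>2 * 2 ^ d)) ^ j * fact j ^ d * real n ^ j"
      using j by (intro mult_right_mono two_mult_power_le) auto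
    finally show "(\<integral>x. ?S x ^ (2 * j) \<partial>gauss_Rn n)
      \<le> (2 * (4 * B\<^sup>2 * 2 ^ d)) ^ j * fact j ^ d * real n ^ j" .
  qed
qed

section \<open>Concentration of the Gaussian norm\<close>

lemma std_normal_second_moment: "std_normal_moment 2 = 1"
  using std_normal_distribution_even_moments(1)[of 1] by simp

text \<open>The relative deviation of the squared norm from its mean \<open>n\<close>, written with
  centered summands so that the power sum bound applies.\<close>

definition norm_excess :: "nat \<Rightarrow> (nat \<Rightarrow> real) \<Rightarrow> real" where
  "norm_excess n x = (\<Sum>i=1..n. (x i)\<^sup>2 - 1) / real n"

lemma measurable_norm_excess [measurable]: "norm_excess n \<in> borel_measurable (gauss_Rn n)"
  unfolding norm_excess_def[abs_def] by measurable

lemma L2_set_eq_norm_excess: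
  assumes "1 \<le> n"
  shows "(L2_set x {1..n})\<^sup>2 = real n * (1 + norm_excess n x)"
  using assms by (simp add: L2_set_def norm_excess_def sum_nonneg sum_subtractf field_simps)

lemma norm_excess_ge: "1 \<le> n \<Longrightarrow> -1 \<le> norm_excess n x"
  using L2_set_eq_norm_excess[of n x] zero_le_power2[of "L2_set x {1..n}"]
  by (simp add: zero_le_mult_iff)

text \<open>The power sum bound for exponent 2 and unit coefficients, whose Euclidean norm is
  \<open>sqrt n\<close>; the division by \<open>n\<close> leaves a decay of \<open>n\<close> to the
  power \<open>- l\<close>.\<close>

lemma norm_excess_moments:
  "\<exists>C>0. \<forall>n\<ge>1. (\<forall>k. integrable (gauss_Rn n) (\<lambda>x. norm_excess n x ^ k)) \<and>
     (\<integral>x. norm_excess n x \<partial>gauss_Rn n) = 0 \<and>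
     (\<forall>l. (\<integral>x. norm_excess n x ^ (2 * l) \<partial>gauss_Rn n) \<le> 2 * (C / real n) ^ l * fact (2 * l))"
proof -
  obtain B where B: "B > 0" and *: "\<And>n a k. n \<ge> 1 \<Longrightarrow> L2_set a {1..n} > 0 \<Longrightarrow>
     integrable (gauss_Rn n) (\<lambda>x. (\<Sum>i\<in>{1..n}. a i * (x i ^ 2 - std_normal_moment 2)) ^ k) \<and>
     \<bar>\<integral>x. (\<Sum>i\<in>{1..n}. a i * (x i ^ 2 - std_normal_moment 2)) ^ k \<partial>gauss_Rn n\<bar>
       \<le> 2 * (2 * B * L2_set a {1..n}) ^ k * sqrt (fact k) ^ 2"
    using gauss_Rn_power_sum_moment_le[of 2] by auto
  show ?thesis
  proof (rule exI[of _ "4 * B\<^sup>2"], intro conjI allI impI)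
    show "0 < 4 * B\<^sup>2" using B by simp
    fix n :: nat assume n: "1 \<le> n"
    have L: "L2_set (\<lambda>_. 1) {1..n} = sqrt (real n)" by (simp add: L2_set_def)
    have eq: "norm_excess n x ^ k = (\<Sum>i\<in>{1..n}. 1 * (x i ^ 2 - std_normal_moment 2)) ^ k / real n ^ k" for x k
      by (simp add: norm_excess_def std_normal_second_moment power_divide)
    note ** = *[OF n, of "\<lambda>_. 1", unfolded L]
    show "integrable (gauss_Rn n) (\<lambda>x. norm_excess n x ^ k)" for k
      unfolding eq using **[of k] n by simp
    have int2: "integrable (gauss_Rn n) (\<lambda>x. (x i)\<^sup>2)" and E2: "(\<integral>x. (x i)\<^sup>2 \<partial>gauss_Rn n) = 1" if "i \<in> {1..n}" for i
      using integrable_gauss_Rn_component[OF that, of "\<lambda>y. y\<^sup>2"] integral_gauss_Rn_component[OF that, of "\<lambda>y. y\<^sup>2"]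
        integrable_std_normal_distribution_moment[of 2] std_normal_second_moment by auto
    show "(\<integral>x. norm_excess n x \<partial>gauss_Rn n) = 0"
      unfolding norm_excess_def using int2 E2 gauss.prob_space[of n] by simp
    show "(\<integral>x. norm_excess n x ^ (2 * l) \<partial>gauss_Rn n) \<le> 2 * (4 * B\<^sup>2 / real n) ^ l * fact (2 * l)" for l
    proof -
      have "(\<integral>x. norm_excess n x ^ (2 * l) \<partial>gauss_Rn n)
          \<le> 2 * (2 * B * sqrt (real n)) ^ (2 * l) * sqrt (fact (2 * l)) ^ 2 / real n ^ (2 * l)"
        unfolding eq using **[of "2 * l"] n by (simp add: divide_right_mono)
      also have "\<dots> = 2 * (4 * B\<^sup>2 / real n) ^ l * fact (2 * l)"
      proof -
        have "(2 * B * sqrt (real n)) ^ (2 * l) = (4 * B\<^sup>2) ^ l * real n ^ l"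
          by (simp add: power_mult power_mult_distrib)
        moreover have "real n ^ (2 * l) = real n ^ l * real n ^ l" by (simp add: mult_2 power_add)
        ultimately show ?thesis using n by (simp add: power_divide)
      qed
      finally show ?thesis .
    qed
  qed
qed

text \<open>The normalised norm to the power \<open>2 * e\<close> is
  \<open>(1 + norm_excess n x) ^ e\<close>, so its distance to 1 is controlled by the first and the
  \<open>e\<close>-th power of the excess. Their moments of order \<open>2 * j\<close> are both of
  the required size.\<close>

lemma gauss_Rn_norm_power_moment_le:
  assumes e: "1 \<le> e"
  shows "\<exists>K>0. \<forall>n\<ge>1. \<forall>j\<ge>1.
     integrable (gauss_Rn n) (\<lambda>x. (1 - (L2_set x {1..n} / sqrt (real n)) ^ (2 * e)) ^ (2 * j)) \<and>
     (\<integral>x. (1 - (L2_set x {1..n} / sqrt (real n)) ^ (2 * e)) ^ (2 * j) \<partial>gauss_Rn n)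
       \<le> K ^ j * fact j ^ (2 * e) / real n ^ j"
proof -
  obtain C where C: "C > 0" and int: "\<And>n k. n \<ge> 1 \<Longrightarrow> integrable (gauss_Rn n) (\<lambda>x. norm_excess n x ^ k)"
    and mom: "\<And>n l. n \<ge> 1 \<Longrightarrow> (\<integral>x. norm_excess n x ^ (2 * l) \<partial>gauss_Rn n) \<le> 2 * (C / real n) ^ l * fact (2 * l)"
    using norm_excess_moments by blast
  \<comment> \<open>The sum of the two geometric bases, one for the first and one for the
    \<open>e\<close>-th power of the excess.\<close>
  define X where "X = 4 * C + C ^ e * 2 ^ (2 * e * (2 * e))"
  have X: "0 < X" using C by (simp add: X_def add_pos_pos)
  show ?thesis
  proof (rule exI[of _ "4 ^ (e + 1) * (2 * (2 * X))"], intro conjI allI impI)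
    \<comment> \<open>The power of 4 comes from the pointwise bound; one factor 2 is that of
      \<open>norm_excess_moments\<close>, the other merges two \<open>j\<close>-th powers.\<close>
    show "0 < 4 ^ (e + 1) * (2 * (2 * X))" using X by simp
    fix n j :: nat assume n: "1 \<le> n" and j: "1 \<le> j"
    let ?y = "norm_excess n"
    have eq: "(L2_set x {1..n} / sqrt (real n)) ^ (2 * e) = (1 + ?y x) ^ e" for x
      using n by (simp add: power_mult power_divide L2_set_eq_norm_excess[OF n])
    have bnd: "(1 - (1 + ?y x) ^ e) ^ (2 * j) \<le> 4 ^ ((e + 1) * j) * (?y x ^ (2 * j) + ?y x ^ (2 * (e * j)))" for x
    proof -
      have "(1 - (1 + ?y x) ^ e) ^ (2 * j) = \<bar>1 - (1 + ?y x) ^ e\<bar> ^ (2 * j)" by (simp add: power_even_abs)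
      also have "\<dots> \<le> (2 ^ e * (\<bar>?y x\<bar> + \<bar>?y x\<bar> ^ e)) ^ (2 * j)"
        by (intro power_mono abs_one_plus_power_diff_le e) simp
      also have "\<dots> = 4 ^ (e * j) * (\<bar>?y x\<bar> + \<bar>?y x\<bar> ^ e) ^ (2 * j)"
      proof -
        have "(2 ^ e :: real) ^ (2 * j) = (2\<^sup>2) ^ (e * j)"
          by (simp only: power_mult[symmetric] mult_ac)
        then show ?thesis by (simp add: power_mult_distrib)
      qed
      also have "\<dots> \<le> 4 ^ (e * j) * (4 ^ j * (\<bar>?y x\<bar> ^ (2 * j) + (\<bar>?y x\<bar> ^ e) ^ (2 * j)))"
        by (intro mult_left_mono add_power_even_le) simp
      also have "(\<bar>?y x\<bar> ^ e) ^ (2 * j) = ?y x ^ (2 * (e * j))"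
        by (simp add: power_mult[symmetric] mult.left_commute[of e] power_even_abs)
      also have "\<bar>?y x\<bar> ^ (2 * j) = ?y x ^ (2 * j)" by (simp add: power_even_abs)
      finally show ?thesis by (simp add: power_add algebra_simps)
    qed
    have intb: "integrable (gauss_Rn n) (\<lambda>x. 4 ^ ((e + 1) * j) * (?y x ^ (2 * j) + ?y x ^ (2 * (e * j))))"
      by (intro integrable_mult_right Bochner_Integration.integrable_add int n)
    have meas: "(\<lambda>x. (1 - (1 + ?y x) ^ e) ^ (2 * j)) \<in> borel_measurable (gauss_Rn n)" by measurable
    have intp: "integrable (gauss_Rn n) (\<lambda>x. (1 - (1 + ?y x) ^ e) ^ (2 * j))"
    proof (rule Bochner_Integration.integrable_bound[OF intb meas])
      show "AE x in gauss_Rn n. norm ((1 - (1 + ?y x) ^ e) ^ (2 * j))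
          \<le> norm (4 ^ ((e + 1) * j) * (?y x ^ (2 * j) + ?y x ^ (2 * (e * j))))"
      proof (intro AE_I2)
        fix x
        have "0 \<le> (1 - (1 + ?y x) ^ e) ^ (2 * j)" by (simp add: zero_le_even_power)
        with bnd[of x] show "norm ((1 - (1 + ?y x) ^ e) ^ (2 * j))
          \<le> norm (4 ^ ((e + 1) * j) * (?y x ^ (2 * j) + ?y x ^ (2 * (e * j))))"
          by (simp only: real_norm_def abs_of_nonneg)
      qed
    qed
    then show "integrable (gauss_Rn n) (\<lambda>x. (1 - (L2_set x {1..n} / sqrt (real n)) ^ (2 * e)) ^ (2 * j))"
      by (simp only: eq)
    have "(\<integral>x. (1 - (1 + ?y x) ^ e) ^ (2 * j) \<partial>gauss_Rn n)
      \<le> (\<integral>x. 4 ^ ((e + 1) * j) * (?y x ^ (2 * j) + ?y x ^ (2 * (e * j))) \<partial>gauss_Rn n)"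
      by (intro integral_mono intp intb bnd)
    also have "\<dots> = 4 ^ ((e + 1) * j) * ((\<integral>x. ?y x ^ (2 * j) \<partial>gauss_Rn n) + (\<integral>x. ?y x ^ (2 * (e * j)) \<partial>gauss_Rn n))"
      using int[OF n] by simp
    also have "\<dots> \<le> 4 ^ ((e + 1) * j) * (2 * ((4 * C) ^ j * fact j ^ (2 * e) / real n ^ j)
        + 2 * ((C ^ e * 2 ^ (2 * e * (2 * e))) ^ j * fact j ^ (2 * e) / real n ^ j))"
    proof (intro mult_left_mono add_mono)
      have "(\<integral>x. ?y x ^ (2 * j) \<partial>gauss_Rn n) \<le> 2 * (C / real n) ^ j * fact (2 * j)" by (rule mom[OF n])
      also have "\<dots> \<le> 2 * (C / real n) ^ j * (4 ^ j * fact j ^ (2 * e))"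
      proof (intro mult_left_mono)
        have "4 ^ j * (fact j ^ 2 :: real) \<le> 4 ^ j * fact j ^ (2 * e)"
          using e by (intro mult_left_mono power_increasing) (auto simp: fact_ge_1)
        then show "fact (2 * j) \<le> 4 ^ j * (fact j ^ (2 * e) :: real)"
          using fact_double_le[of j] by linarith
      qed (use C in auto)
      also have "\<dots> = 2 * ((4 * C) ^ j * fact j ^ (2 * e) / real n ^ j)"
        by (simp add: power_mult_distrib power_divide)
      finally show "(\<integral>x. ?y x ^ (2 * j) \<partial>gauss_Rn n) \<le> 2 * ((4 * C) ^ j * fact j ^ (2 * e) / real n ^ j)" .
      have "(\<integral>x. ?y x ^ (2 * (e * j)) \<partial>gauss_Rn n) \<le> 2 * (C / real n) ^ (e * j) * fact (2 * e * j)"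
        using mom[OF n, of "e * j"] by (simp add: mult.assoc)
      \<comment> \<open>The available decay in \<open>n\<close> is of order \<open>e * j\<close>;
        only order \<open>j\<close> is kept, to match the first term.\<close>
      also have "\<dots> \<le> 2 * (C ^ (e * j) / real n ^ j) * ((2 ^ (2 * e * (2 * e))) ^ j * fact j ^ (2 * e))"
      proof (intro mult_mono fact_mult_le mult_left_mono)
        have "real n ^ j \<le> real n ^ (e * j)" using n e by (intro power_increasing) auto
        then show "(C / real n) ^ (e * j) \<le> C ^ (e * j) / real n ^ j"
          using n C unfolding power_divide by (intro divide_left_mono) auto
      qed (use C in auto)
      also have "\<dots> = 2 * ((C ^ e * 2 ^ (2 * e * (2 * e))) ^ j * fact j ^ (2 * e) / real n ^ j)"
        by (simp add: power_mult_distrib power_mult[of C])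
      finally show "(\<integral>x. ?y x ^ (2 * (e * j)) \<partial>gauss_Rn n)
        \<le> 2 * ((C ^ e * 2 ^ (2 * e * (2 * e))) ^ j * fact j ^ (2 * e) / real n ^ j)" .
    qed simp
    also have "\<dots> = 4 ^ ((e + 1) * j) * 2 * ((4 * C) ^ j + (C ^ e * 2 ^ (2 * e * (2 * e))) ^ j) * fact j ^ (2 * e) / real n ^ j"
      by (simp add: algebra_simps add_divide_distrib)
    also have "\<dots> \<le> 4 ^ ((e + 1) * j) * 2 * (2 * X ^ j) * fact j ^ (2 * e) / real n ^ j"
      unfolding X_def using C
      by (intro divide_right_mono mult_right_mono mult_left_mono power_add_power_le) auto
    also have "\<dots> \<le> 4 ^ ((e + 1) * j) * (2 * (2 * X)) ^ j * fact j ^ (2 * e) / real n ^ j"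
    proof -
      have "2 * (2 * X ^ j) \<le> 2 * (2 * X) ^ j" using two_mult_power_le[OF j, of X] X by simp
      also have "\<dots> \<le> (2 * (2 * X)) ^ j" using X by (intro two_mult_power_le j) simp
      finally have "4 ^ ((e + 1) * j) * (2 * (2 * X ^ j)) \<le> 4 ^ ((e + 1) * j) * (2 * (2 * X)) ^ j"
        by (intro mult_left_mono) auto
      then show ?thesis by (intro divide_right_mono mult_right_mono) (auto simp: mult.assoc)
    qed
    also have "4 ^ ((e + 1) * j) * (2 * (2 * X)) ^ j = (4 ^ (e + 1) * (2 * (2 * X))) ^ j"
      by (simp only: power_mult power_mult_distrib)
    finally show "(\<integral>x. (1 - (L2_set x {1..n} / sqrt (real n)) ^ (2 * e)) ^ (2 * j) \<partial>gauss_Rn n)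
       \<le> (4 ^ (e + 1) * (2 * (2 * X))) ^ j * fact j ^ (2 * e) / real n ^ j"
      by (simp only: eq)
  qed
qed

text \<open>Jensen's inequality in the form of Bernoulli's:
  \<open>(1 + y) ^ p \<ge> 1 + p * y\<close> for \<open>y \<ge> -1\<close>, and the excess
  \<open>y\<close> has mean zero.\<close>

lemma gauss_Rn_norm_even_moment_ge:
  assumes n: "1 \<le> n"
  shows "ennreal (real n ^ p) \<le> (\<integral>\<^sup>+x. ennreal (L2_set x {1..n} ^ (2 * p)) \<partial>gauss_Rn n)"
proof -
  let ?y = "norm_excess n"
  have int: "integrable (gauss_Rn n) (\<lambda>x. ?y x ^ k)" and E0: "(\<integral>x. ?y x \<partial>gauss_Rn n) = 0" for k
    using norm_excess_moments n by blast+
  have int1: "integrable (gauss_Rn n) ?y" using int[of 1] by simp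
  have eq: "L2_set x {1..n} ^ (2 * p) = real n ^ p * (1 + ?y x) ^ p" for x
    by (simp add: power_mult L2_set_eq_norm_excess[OF n] power_mult_distrib)
  have intp: "integrable (gauss_Rn n) (\<lambda>x. (?y x + 1) ^ p)"
    unfolding binomial_ring by (intro Bochner_Integration.integrable_sum) (simp add: int)
  then have intL: "integrable (gauss_Rn n) (\<lambda>x. L2_set x {1..n} ^ (2 * p))"
    by (simp add: eq add.commute)
  have "1 = (\<integral>x. 1 + real p * ?y x \<partial>gauss_Rn n)"
    using int1 E0 gauss.prob_space[of n] by simp
  also have "\<dots> \<le> (\<integral>x. (?y x + 1) ^ p \<partial>gauss_Rn n)"
    using int1 intp Bernoulli_inequality[OF norm_excess_ge[OF n]]
    by (intro integral_mono) (auto simp: add.commute)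
  finally have "real n ^ p * 1 \<le> real n ^ p * (\<integral>x. (?y x + 1) ^ p \<partial>gauss_Rn n)"
    by (intro mult_left_mono) auto
  also have "\<dots> = (\<integral>x. L2_set x {1..n} ^ (2 * p) \<partial>gauss_Rn n)"
    by (simp add: eq add.commute)
  finally have "ennreal (real n ^ p) \<le> ennreal (\<integral>x. L2_set x {1..n} ^ (2 * p) \<partial>gauss_Rn n)"
    by (simp add: ennreal_leI)
  also have "\<dots> = (\<integral>\<^sup>+x. ennreal (L2_set x {1..n} ^ (2 * p)) \<partial>gauss_Rn n)"
    using intL by (intro nn_integral_eq_integral[symmetric]) (auto simp: zero_le_even_power)
  finally show ?thesis .
qed

text \<open>
  The constant c is chosen so that the form \<open>Q - c \<parallel>x\<parallel>\<^sup>d\<close> splits into a centered sum and a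
  multiple of \<open>1 - (\<parallel>x\<parallel> / sqrt n)\<^sup>d\<close>; for odd d the second part is absent.
\<close>

lemma gauss_Rn_form_moment_le:
  assumes d: "2 \<le> d"
  shows "\<exists>K>0. \<forall>n\<ge>1. \<forall>a. (\<Sum>i=1..n. (a i)\<^sup>2) = real n \<longrightarrow> (\<exists>c. \<forall>j\<ge>1.
     integrable (gauss_Rn n) (\<lambda>x. (Q_poly n d a x - c * L2_set x {1..n} ^ d) ^ (2 * j)) \<and>
     (\<integral>x. (Q_poly n d a x - c * L2_set x {1..n} ^ d) ^ (2 * j) \<partial>gauss_Rn n)
       \<le> K ^ j * fact j ^ d * real n ^ j)"
proof -
  define m where "m = std_normal_moment d"
  obtain K1 where K1: "K1 > 0" and S: "\<And>n a j. 1 \<le> n \<Longrightarrow> (\<Sum>i=1..n. (a i)\<^sup>2) = real n \<Longrightarrow> 1 \<le> j \<Longrightarrow>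
     integrable (gauss_Rn n) (\<lambda>x. (\<Sum>i\<in>{1..n}. a i * (x i ^ d - m)) ^ (2 * j)) \<and>
     (\<integral>x. (\<Sum>i\<in>{1..n}. a i * (x i ^ d - m)) ^ (2 * j) \<partial>gauss_Rn n) \<le> K1 ^ j * fact j ^ d * real n ^ j"
    using gauss_Rn_power_sum_even_moment_le[OF d] unfolding m_def by blast
  obtain K2 where K2: "K2 > 0" and N: "\<And>n j. 1 \<le> n \<Longrightarrow> 1 \<le> j \<Longrightarrow>
     integrable (gauss_Rn n) (\<lambda>x. (m * (1 - (L2_set x {1..n} / sqrt (real n)) ^ d)) ^ (2 * j)) \<and>
     (\<integral>x. (m * (1 - (L2_set x {1..n} / sqrt (real n)) ^ d)) ^ (2 * j) \<partial>gauss_Rn n)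
        \<le> K2 ^ j * fact j ^ d / real n ^ j"
  proof (cases "even d")
    case True
    then obtain e where e: "d = 2 * e" by blast
    with d have "1 \<le> e" by simp
    from gauss_Rn_norm_power_moment_le[OF this] obtain K where K: "K > 0"
      and *: "\<And>n j. 1 \<le> n \<Longrightarrow> 1 \<le> j \<Longrightarrow>
        integrable (gauss_Rn n) (\<lambda>x. (1 - (L2_set x {1..n} / sqrt (real n)) ^ d) ^ (2 * j)) \<and>
        (\<integral>x. (1 - (L2_set x {1..n} / sqrt (real n)) ^ d) ^ (2 * j) \<partial>gauss_Rn n)
          \<le> K ^ j * fact j ^ d / real n ^ j" unfolding e by blast
    \<comment> \<open>The summand 1 keeps the constant positive without any information on
      \<open>m\<close>.\<close>
    show thesis
    proof (rule that[of "(m\<^sup>2 + 1) * K"])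
      show "0 < (m\<^sup>2 + 1) * K" using K by (simp add: add_nonneg_pos)
      fix n j :: nat assume n: "1 \<le> n" and j: "1 \<le> j"
      let ?g = "\<lambda>x. 1 - (L2_set x {1..n} / sqrt (real n)) ^ d"
      note ** = *[OF n j]
      have "(\<integral>x. (m * ?g x) ^ (2 * j) \<partial>gauss_Rn n) = (m\<^sup>2) ^ j * (\<integral>x. ?g x ^ (2 * j) \<partial>gauss_Rn n)"
        by (simp add: power_mult_distrib power_mult)
      also have "\<dots> \<le> (m\<^sup>2 + 1) ^ j * (K ^ j * fact j ^ d / real n ^ j)"
        using ** by (intro mult_mono power_mono) (auto simp: zero_le_even_power)
      finally show "integrable (gauss_Rn n) (\<lambda>x. (m * ?g x) ^ (2 * j)) \<and>
        (\<integral>x. (m * ?g x) ^ (2 * j) \<partial>gauss_Rn n) \<le> ((m\<^sup>2 + 1) * K) ^ j * fact j ^ d / real n ^ j"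
        using ** by (simp add: power_mult_distrib)
    qed
  next
    case False
    then have "m = 0" unfolding m_def by (rule integral_std_normal_distribution_moment_odd)
    then show thesis by (intro that[of 1]) (auto simp: zero_power)
  qed
  show ?thesis
  proof (rule exI[of _ "4 * (2 * (K1 + K2))"], intro conjI allI impI)
    show "0 < 4 * (2 * (K1 + K2))" using K1 K2 by simp
    fix n and a :: "nat \<Rightarrow> real" assume n: "1 \<le> n" and a: "(\<Sum>i=1..n. (a i)\<^sup>2) = real n"
    define A where "A = (\<Sum>i=1..n. a i)"
    define c where "c = m * A / sqrt (real n) ^ d"
    let ?S = "\<lambda>x. \<Sum>i\<in>{1..n}. a i * (x i ^ d - m)"
    let ?R = "\<lambda>x. m * (1 - (L2_set x {1..n} / sqrt (real n)) ^ d)"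
    \<comment> \<open>By Cauchy-Schwarz \<open>A\<close> may be as large as \<open>n\<close>. Its
      power of order \<open>2 * j\<close>, against the decay \<open>n\<close> to the power
      \<open>- j\<close> of the norm fluctuation, leaves \<open>n ^ j\<close>, the same order as for
      the centered sum.\<close>
    have "A\<^sup>2 \<le> real n * real n"
      using Cauchy_Schwarz_ineq_sum[of "\<lambda>_. 1" a "{1..n}"] by (simp add: A_def a)
    then have A2: "A\<^sup>2 \<le> (real n)\<^sup>2" by (simp add: power2_eq_square)
    have split: "Q_poly n d a x - c * L2_set x {1..n} ^ d = ?S x + A * ?R x" for x
      by (simp add: Q_poly_def c_def A_def sum_subtractf algebra_simps power_divide sum_distrib_left sum_distrib_right)
    show "\<exists>c. \<forall>j\<ge>1.
     integrable (gauss_Rn n) (\<lambda>x. (Q_poly n d a x - c * L2_set x {1..n} ^ d) ^ (2 * j)) \<and>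
     (\<integral>x. (Q_poly n d a x - c * L2_set x {1..n} ^ d) ^ (2 * j) \<partial>gauss_Rn n)
       \<le> (4 * (2 * (K1 + K2))) ^ j * fact j ^ d * real n ^ j"
    proof (intro exI[of _ c] allI impI)
      fix j :: nat assume j: "1 \<le> j"
      note S' = S[OF n a j] and N' = N[OF n j]
      have intb: "integrable (gauss_Rn n) (\<lambda>x. 4 ^ j * (?S x ^ (2 * j) + A ^ (2 * j) * ?R x ^ (2 * j)))"
        using S' N' by (intro integrable_mult_right Bochner_Integration.integrable_add) blast+
      have meas: "(\<lambda>x. (?S x + A * ?R x) ^ (2 * j)) \<in> borel_measurable (gauss_Rn n)" by measurable
      have bnd: "(?S x + A * ?R x) ^ (2 * j) \<le> 4 ^ j * (?S x ^ (2 * j) + A ^ (2 * j) * ?R x ^ (2 * j))" for x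
        using add_power_even_le[of "?S x" "A * ?R x" j] by (simp add: power_mult_distrib)
      have int: "integrable (gauss_Rn n) (\<lambda>x. (?S x + A * ?R x) ^ (2 * j))"
      proof (rule Bochner_Integration.integrable_bound[OF intb meas], intro AE_I2)
        fix x
        have "norm ((?S x + A * ?R x) ^ (2 * j)) = (?S x + A * ?R x) ^ (2 * j)"
          by (simp only: real_norm_def abs_of_nonneg zero_le_even_power even_mult_iff even_numeral simp_thms)
        also note bnd[of x]
        also have "y \<le> norm y" for y :: real by simp
        finally show "norm ((?S x + A * ?R x) ^ (2 * j))
          \<le> norm (4 ^ j * (?S x ^ (2 * j) + A ^ (2 * j) * ?R x ^ (2 * j)))" .
      qed
      have "(\<integral>x. (?S x + A * ?R x) ^ (2 * j) \<partial>gauss_Rn n)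
         \<le> (\<integral>x. 4 ^ j * (?S x ^ (2 * j) + A ^ (2 * j) * ?R x ^ (2 * j)) \<partial>gauss_Rn n)"
        by (intro integral_mono int intb bnd)
      also have "\<dots> = 4 ^ j * ((\<integral>x. ?S x ^ (2 * j) \<partial>gauss_Rn n) + A ^ (2 * j) * (\<integral>x. ?R x ^ (2 * j) \<partial>gauss_Rn n))"
        using S' N' by (subst integral_mult_right_zero, subst Bochner_Integration.integral_add)
          (auto simp del: power_mult_distrib intro!: integrable_mult_right)
      also have "\<dots> \<le> 4 ^ j * (K1 ^ j * fact j ^ d * real n ^ j
          + (real n ^ j * real n ^ j) * (K2 ^ j * fact j ^ d / real n ^ j))"
      proof (intro mult_left_mono add_mono mult_mono)
        have "(A\<^sup>2) ^ j \<le> ((real n)\<^sup>2) ^ j" by (rule power_mono[OF A2]) simp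
        then show "A ^ (2 * j) \<le> real n ^ j * real n ^ j"
          by (simp add: power_mult power2_eq_square power_mult_distrib)
      qed (use S' N' in \<open>auto simp: zero_le_even_power\<close>)
      also have "\<dots> = 4 ^ j * (K1 ^ j + K2 ^ j) * fact j ^ d * real n ^ j"
        using n by (simp add: field_simps)
      also have "\<dots> \<le> 4 ^ j * (2 * (K1 + K2)) ^ j * fact j ^ d * real n ^ j"
        using power_add_power_le[of K1 K2 j] two_mult_power_le[OF j, of "K1 + K2"] K1 K2
        by (intro mult_right_mono mult_left_mono) auto
      finally show "integrable (gauss_Rn n) (\<lambda>x. (Q_poly n d a x - c * L2_set x {1..n} ^ d) ^ (2 * j)) \<and>
       (\<integral>x. (Q_poly n d a x - c * L2_set x {1..n} ^ d) ^ (2 * j) \<partial>gauss_Rn n)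
         \<le> (4 * (2 * (K1 + K2))) ^ j * fact j ^ d * real n ^ j"
        using int unfolding split by (simp only: power_mult_distrib simp_thms)
    qed
  qed
qed

section \<open>Moments on the sphere\<close>

lemma measurable_Q_poly [measurable]: "Q_poly n d a \<in> borel_measurable (lebesgue_Rn n)"
  unfolding Q_poly_def[abs_def] by measurable

lemma Q_poly_sphere_bound:
  assumes "\<theta> \<in> unit_sphere_Rn n"
  shows "\<bar>Q_poly n d a \<theta>\<bar> \<le> (\<Sum>i=1..n. \<bar>a i\<bar>)"
proof -
  have "\<bar>\<theta> i\<bar> \<le> 1" if "i \<in> {1..n}" for i
  proof -
    have "\<bar>\<theta> i\<bar> \<le> L2_set (\<lambda>i. \<bar>\<theta> i\<bar>) {1..n}" using that by (intro member_le_L2_set) auto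
    also have "\<dots> = 1" using assms by (simp add: unit_sphere_Rn_def L2_set_def)
    finally show ?thesis .
  qed
  then have "\<bar>a i * \<theta> i ^ d\<bar> \<le> \<bar>a i\<bar>" if "i \<in> {1..n}" for i
    using that by (simp add: abs_mult power_abs mult_left_le power_le_one)
  then show ?thesis
    unfolding Q_poly_def by (intro order_trans[OF sum_abs] sum_mono)
qed

lemma integrable_sphere_Q_poly_power:
  assumes "1 \<le> n"
  shows "integrable (sphere_unif n) (\<lambda>\<theta>. (Q_poly n d a \<theta> - c) ^ k)"
proof -
  interpret prob_space "sphere_unif n" using assms by (rule prob_space_sphere_unif)
  show ?thesis
  proof (rule integrable_const_bound[where B="((\<Sum>i=1..n. \<bar>a i\<bar>) + \<bar>c\<bar>) ^ k"])
    show "AE \<theta> in sphere_unif n. norm ((Q_poly n d a \<theta> - c) ^ k) \<le> ((\<Sum>i=1..n. \<bar>a i\<bar>) + \<bar>c\<bar>) ^ k"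
    proof (intro AE_I2)
      fix \<theta> assume "\<theta> \<in> space (sphere_unif n)"
      then have "\<bar>Q_poly n d a \<theta> - c\<bar> \<le> (\<Sum>i=1..n. \<bar>a i\<bar>) + \<bar>c\<bar>"
        using Q_poly_sphere_bound[of \<theta> n d a] abs_triangle_ineq4[of "Q_poly n d a \<theta>" c] by simp
      then show "norm ((Q_poly n d a \<theta> - c) ^ k) \<le> ((\<Sum>i=1..n. \<bar>a i\<bar>) + \<bar>c\<bar>) ^ k"
        by (simp add: power_abs power_mono)
    qed
    show "(\<lambda>\<theta>. (Q_poly n d a \<theta> - c) ^ k) \<in> borel_measurable (sphere_unif n)"
      by (intro measurable_sphere_unif) measurable
  qed
qed

lemma Q_poly_radial_proj:
  assumes "L2_set x {1..n} \<noteq> 0"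
  shows "L2_set x {1..n} ^ d * Q_poly n d a (radial_proj n x) = Q_poly n d a x"
  using assms by (simp add: Q_poly_def radial_proj_def sum_distrib_left power_divide)

text \<open>Homogeneity of degree \<open>d\<close> turns the Gaussian moment of the form into a norm
  moment times the moment on the sphere. Dividing by the lower bound \<open>real n ^ (d * j)\<close>
  turns \<open>real n ^ j\<close> into the decay. The center \<open>c\<close> is the Gaussian one
  and need not be the mean on the sphere.\<close>

lemma sphere_Q_poly_moment_le:
  assumes d: "2 \<le> d"
  shows "\<exists>K>0. \<forall>n\<ge>1. \<forall>a. (\<Sum>i=1..n. (a i)\<^sup>2) = real n \<longrightarrow> (\<exists>c. \<forall>j\<ge>1.
     (\<integral>\<theta>. (Q_poly n d a \<theta> - c) ^ (2 * j) \<partial>sphere_unif n) \<le> K ^ j * fact j ^ d / real n ^ ((d - 1) * j))"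
proof -
  obtain K where K: "K > 0" and *: "\<And>n a. 1 \<le> n \<Longrightarrow> (\<Sum>i=1..n. (a i)\<^sup>2) = real n \<Longrightarrow> \<exists>c. \<forall>j\<ge>1.
     integrable (gauss_Rn n) (\<lambda>x. (Q_poly n d a x - c * L2_set x {1..n} ^ d) ^ (2 * j)) \<and>
     (\<integral>x. (Q_poly n d a x - c * L2_set x {1..n} ^ d) ^ (2 * j) \<partial>gauss_Rn n)
       \<le> K ^ j * fact j ^ d * real n ^ j"
    using gauss_Rn_form_moment_le[OF d] by blast
  show ?thesis
  proof (rule exI[of _ K], intro conjI K allI impI)
    fix n and a :: "nat \<Rightarrow> real" assume n: "1 \<le> n" and a: "(\<Sum>i=1..n. (a i)\<^sup>2) = real n"
    from *[OF this] obtain c where c: "\<And>j. 1 \<le> j \<Longrightarrow>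
     integrable (gauss_Rn n) (\<lambda>x. (Q_poly n d a x - c * L2_set x {1..n} ^ d) ^ (2 * j)) \<and>
     (\<integral>x. (Q_poly n d a x - c * L2_set x {1..n} ^ d) ^ (2 * j) \<partial>gauss_Rn n)
       \<le> K ^ j * fact j ^ d * real n ^ j" by blast
    show "\<exists>c. \<forall>j\<ge>1. (\<integral>\<theta>. (Q_poly n d a \<theta> - c) ^ (2 * j) \<partial>sphere_unif n)
      \<le> K ^ j * fact j ^ d / real n ^ ((d - 1) * j)"
    proof (intro exI[of _ c] allI impI)
      fix j :: nat assume j: "1 \<le> j"
      let ?f = "\<lambda>\<theta>. (Q_poly n d a \<theta> - c) ^ (2 * j)"
      let ?T = "\<lambda>x. (Q_poly n d a x - c * L2_set x {1..n} ^ d) ^ (2 * j)"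
      define E where "E = (\<integral>\<theta>. ?f \<theta> \<partial>sphere_unif n)"
      have E: "0 \<le> E" unfolding E_def by (simp add: zero_le_even_power)
      have nnE: "(\<integral>\<^sup>+\<theta>. ennreal (?f \<theta>) \<partial>sphere_unif n) = ennreal E"
        unfolding E_def using n by (intro nn_integral_eq_integral integrable_sphere_Q_poly_power)
          (auto simp: zero_le_even_power)
      have T: "ennreal (L2_set x {1..n} ^ (2 * (d * j))) * ennreal (?f (radial_proj n x)) = ennreal (?T x)"
        if "L2_set x {1..n} \<noteq> 0" for x
      proof -
        have "L2_set x {1..n} ^ (2 * (d * j)) * ?f (radial_proj n x)
           = (L2_set x {1..n} ^ d * (Q_poly n d a (radial_proj n x) - c)) ^ (2 * j)"
          by (simp add: power_mult_distrib power_mult[symmetric] mult_ac)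
        also have "\<dots> = ?T x"
          using Q_poly_radial_proj[OF that, of d a] by (simp add: algebra_simps)
        finally show ?thesis by (simp add: ennreal_mult'[symmetric] L2_set_nonneg)
      qed
      have AE: "AE x in gauss_Rn n. L2_set x {1..n} \<noteq> 0"
        unfolding gauss_Rn_eq_density using AE_lebesgue_Rn_L2_set_pos[OF n]
        by (subst AE_density) (auto elim!: eventually_mono)
      have "ennreal (real n ^ (d * j)) * ennreal E
        \<le> (\<integral>\<^sup>+x. ennreal (L2_set x {1..n} ^ (2 * (d * j))) \<partial>gauss_Rn n) * ennreal E"
        by (intro mult_right_mono gauss_Rn_norm_even_moment_ge n) simp
      also have "\<dots> = (\<integral>\<^sup>+x. ennreal (L2_set x {1..n} ^ (2 * (d * j))) * ennreal (?f (radial_proj n x)) \<partial>gauss_Rn n)"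
        unfolding nnE[symmetric] by (rule nn_integral_gauss_Rn_polar[OF n, symmetric]) (auto simp: nnE)
      also have "\<dots> = (\<integral>\<^sup>+x. ennreal (?T x) \<partial>gauss_Rn n)"
        using AE T by (intro nn_integral_cong_AE) (auto elim!: eventually_mono)
      also have "\<dots> = ennreal (\<integral>x. ?T x \<partial>gauss_Rn n)"
        using c[OF j] by (intro nn_integral_eq_integral) (auto simp: zero_le_even_power)
      also have "\<dots> \<le> ennreal (K ^ j * fact j ^ d * real n ^ j)"
        using c[OF j] by (intro ennreal_leI) blast
      finally have "real n ^ (d * j) * E \<le> K ^ j * fact j ^ d * real n ^ j"
        using E K by (simp add: ennreal_mult'[symmetric])
      also have "real n ^ (d * j) = real n ^ ((d - 1) * j) * real n ^ j"
        using d by (simp add: power_add[symmetric] algebra_simps)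
      finally have "(real n ^ ((d - 1) * j) * E) * real n ^ j \<le> (K ^ j * fact j ^ d) * real n ^ j"
        by (simp only: mult_ac)
      then have "real n ^ ((d - 1) * j) * E \<le> K ^ j * fact j ^ d"
        by (rule mult_right_le_imp_le) (use n in simp)
      then show "(\<integral>\<theta>. ?f \<theta> \<partial>sphere_unif n) \<le> K ^ j * fact j ^ d / real n ^ ((d - 1) * j)"
        using n unfolding E_def by (simp add: pos_le_divide_eq mult.commute)
    qed
  qed
qed

section \<open>From moment growth to exponential integrability\<close>

text \<open>A scaled form of \<open>s powr (1 / d) \<le> 1 + s\<close>. With \<open>t\<close> a
  bound for the mean of \<open>y\<close>, it serves as a pointwise substitute for Jensen's
  inequality for the \<open>d\<close>-th root, at the cost of a factor 2.\<close>

lemma powr_inverse_le_scaled: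
  fixes t y :: real
  assumes "0 < t" "0 \<le> y" "1 \<le> d"
  shows "y powr (1 / real d) \<le> t powr (1 / real d) * (1 + y / t)"
proof -
  have "(y / t) powr (1 / real d) \<le> 1 + y / t"
  proof (cases "y / t \<le> 1")
    case True
    then have "(y / t) powr (1 / real d) \<le> 1" using assms by (intro powr_le1) auto
    then show ?thesis using assms by (simp add: add_increasing2)
  next
    case False
    then have "(y / t) powr (1 / real d) \<le> (y / t) powr 1"
      using assms by (intro powr_mono) auto
    also have "\<dots> = y / t" using assms by simp
    finally show ?thesis by simp
  qed
  then have "t powr (1 / real d) * (y / t) powr (1 / real d) \<le> t powr (1 / real d) * (1 + y / t)"
    by (intro mult_left_mono) auto
  then show ?thesis using assms by (simp add: powr_divide)
qed

lemma (in prob_space) nn_integral_exp_powr_le_2: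
  fixes X :: "'a \<Rightarrow> real"
  assumes d: "1 \<le> d" and K: "0 < K" and X [measurable]: "X \<in> borel_measurable M"
    and int: "\<And>j. 1 \<le> j \<Longrightarrow> integrable M (\<lambda>x. X x ^ (2 * j))"
    and mom: "\<And>j. 1 \<le> j \<Longrightarrow> expectation (\<lambda>x. X x ^ (2 * j)) \<le> K ^ j * fact j ^ d"
  shows "(\<integral>\<^sup>+x. ennreal (exp (1 / (3 * K powr (1 / real d)) * \<bar>X x\<bar> powr (2 / real d))) \<partial>M) \<le> 2"
proof -
  \<comment> \<open>The 3 makes term \<open>j\<close> of the exponential series at most
    \<open>2 * (1 / 3) ^ j\<close> for \<open>j \<ge> 1\<close>; together with the term 1 at
    \<open>j = 0\<close> these bounds sum to exactly 2.\<close>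
  define c where "c = 1 / (3 * K powr (1 / real d))"
  define b :: "nat \<Rightarrow> real" where "b = (\<lambda>j. 2 * (1 / 3) ^ j - (if j = 0 then 1 else 0))"
  have c: "0 < c" using K by (simp add: c_def)
  have b: "0 \<le> b j" for j by (simp add: b_def)
  have "(\<lambda>j. 2 * (1 / 3 :: real) ^ j) sums (2 * (1 / (1 - 1 / 3)))"
    by (intro sums_mult geometric_sums) simp
  moreover have "(\<lambda>j::nat. if j = 0 then 1 else 0 :: real) sums 1"
    using sums_single[of 0 "\<lambda>_. 1 :: real"] by simp
  ultimately have "b sums (2 * (1 / (1 - 1 / 3)) - 1)" unfolding b_def by (rule sums_diff)
  then have b_sums: "b sums 2" by simp
  let ?y = "\<lambda>x. c * \<bar>X x\<bar> powr (2 / real d)"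
  have term_le: "(\<integral>\<^sup>+x. ennreal (?y x ^ j / fact j) \<partial>M) \<le> ennreal (b j)" for j
  proof (cases "j = 0")
    case True
    then show ?thesis by (simp add: b_def emeasure_space_1)
  next
    case False
    then have j: "1 \<le> j" by simp
    \<comment> \<open>The assumed moment bound: its \<open>d\<close>-th root contains
      \<open>fact j\<close> to the first power, which cancels the factorial of the exponential
      series.\<close>
    define t where "t = K ^ j * fact j ^ d"
    have t: "0 < t" using K by (simp add: t_def)
    have t': "t powr (1 / real d) = (K powr (1 / real d)) ^ j * fact j"
    proof -
      have "(K ^ j) powr (1 / real d) = (K powr (1 / real d)) ^ j"
        using K by (simp add: powr_realpow[symmetric] powr_powr mult.commute)
      moreover have "(fact j ^ d) powr (1 / real d) = (fact j :: real)"
        using d by (simp add: powr_realpow[symmetric] powr_powr)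
      ultimately show ?thesis using K by (simp add: t_def powr_mult)
    qed
    have bnd: "?y x ^ j / fact j \<le> (1 / 3) ^ j * (1 + X x ^ (2 * j) / t)" for x
    proof -
      have "(\<bar>X x\<bar> powr (2 / real d)) ^ j = (X x ^ (2 * j)) powr (1 / real d)"
      proof (cases "X x = 0")
        case True
        then show ?thesis using j by (simp add: zero_power)
      next
        case False
        then have "(\<bar>X x\<bar> ^ (2 * j)) powr (1 / real d) = (\<bar>X x\<bar> powr (2 / real d)) ^ j"
          by (simp add: powr_realpow[symmetric] powr_powr mult.commute del: power_abs)
        then show ?thesis by (simp add: power_even_abs)
      qed
      also have "\<dots> \<le> t powr (1 / real d) * (1 + X x ^ (2 * j) / t)"
        using t d by (intro powr_inverse_le_scaled) (auto simp: zero_le_even_power)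
      finally have "c ^ j * (\<bar>X x\<bar> powr (2 / real d)) ^ j / fact j
          \<le> c ^ j * (t powr (1 / real d) * (1 + X x ^ (2 * j) / t)) / fact j"
        using c by (intro divide_right_mono mult_left_mono) auto
      also have "\<dots> = (c * K powr (1 / real d)) ^ j * (1 + X x ^ (2 * j) / t)"
        by (simp add: t' power_mult_distrib)
      also have "c * K powr (1 / real d) = 1 / 3" using K by (simp add: c_def)
      finally show ?thesis by (simp add: power_mult_distrib)
    qed
    have "(\<integral>\<^sup>+x. ennreal (?y x ^ j / fact j) \<partial>M) \<le> (\<integral>\<^sup>+x. ennreal ((1 / 3) ^ j * (1 + X x ^ (2 * j) / t)) \<partial>M)"
      by (intro nn_integral_mono ennreal_leI bnd)
    also have "\<dots> = ennreal (\<integral>x. (1 / 3) ^ j * (1 + X x ^ (2 * j) / t) \<partial>M)"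
      using int[OF j] t by (intro nn_integral_eq_integral) (auto simp: zero_le_even_power intro!: AE_I2 add_nonneg_nonneg)
    also have "(\<integral>x. (1 / 3) ^ j * (1 + X x ^ (2 * j) / t) \<partial>M) = (1 / 3) ^ j * (1 + expectation (\<lambda>x. X x ^ (2 * j)) / t)"
      using int[OF j] prob_space by simp
    also have "\<dots> \<le> (1 / 3) ^ j * (1 + 1)"
      using mom[OF j] t by (intro mult_left_mono add_left_mono) (auto simp: t_def)
    finally show ?thesis using False by (simp add: b_def mult.commute ennreal_leI)
  qed
  have "(\<integral>\<^sup>+x. ennreal (exp (?y x)) \<partial>M) = (\<integral>\<^sup>+x. (\<Sum>j. ennreal (?y x ^ j / fact j)) \<partial>M)"
  proof (intro nn_integral_cong)
    fix x
    have "(\<lambda>j. ?y x ^ j / fact j) sums exp (?y x)"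
      using exp_converges[of "?y x"] by (simp add: divide_inverse mult.commute)
    then show "ennreal (exp (?y x)) = (\<Sum>j. ennreal (?y x ^ j / fact j))"
      using c by (intro suminf_ennreal_eq[symmetric]) auto
  qed
  also have "\<dots> = (\<Sum>j. \<integral>\<^sup>+x. ennreal (?y x ^ j / fact j) \<partial>M)"
    by (intro nn_integral_suminf) measurable
  also have "\<dots> \<le> (\<Sum>j. ennreal (b j))"
    by (intro suminf_le term_le) auto
  also have "\<dots> = ennreal 2" by (rule suminf_ennreal_eq[OF b b_sums])
  finally show ?thesis by (simp add: c_def)
qed

text \<open>Replacing \<open>c\<close> by the mean costs only a constant: the squared distance
  between them is at most the second moment about \<open>c\<close>, which the case
  \<open>j = 1\<close> already controls.\<close>

lemma sphere_Q_poly_central_moment_le: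
  assumes d: "2 \<le> d"
  shows "\<exists>K>0. \<forall>n\<ge>1. \<forall>a. (\<Sum>i=1..n. (a i)\<^sup>2) = real n \<longrightarrow> (\<forall>j\<ge>1.
     (\<integral>\<theta>. (Q_poly n d a \<theta> - Q_mean n d a) ^ (2 * j) \<partial>sphere_unif n) \<le> K ^ j * fact j ^ d / real n ^ ((d - 1) * j))"
proof -
  obtain K where K: "K > 0" and *: "\<And>n a. 1 \<le> n \<Longrightarrow> (\<Sum>i=1..n. (a i)\<^sup>2) = real n \<Longrightarrow> \<exists>c. \<forall>j\<ge>1.
     (\<integral>\<theta>. (Q_poly n d a \<theta> - c) ^ (2 * j) \<partial>sphere_unif n) \<le> K ^ j * fact j ^ d / real n ^ ((d - 1) * j)"
    using sphere_Q_poly_moment_le[OF d] by blast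
  show ?thesis
  proof (rule exI[of _ "4 * (2 * K)"], intro conjI allI impI)
    \<comment> \<open>The 4 comes from splitting the even power of a sum, the 2 from its two parts
      having the same bound.\<close>
    show "0 < 4 * (2 * K)" using K by simp
    fix n and a :: "nat \<Rightarrow> real" and j :: nat
    assume n: "1 \<le> n" and a: "(\<Sum>i=1..n. (a i)\<^sup>2) = real n" and j: "1 \<le> j"
    from *[OF n a] obtain c where c: "\<And>j. 1 \<le> j \<Longrightarrow>
     (\<integral>\<theta>. (Q_poly n d a \<theta> - c) ^ (2 * j) \<partial>sphere_unif n) \<le> K ^ j * fact j ^ d / real n ^ ((d - 1) * j)" by blast
    interpret prob_space "sphere_unif n" using n by (rule prob_space_sphere_unif)
    note int = integrable_sphere_Q_poly_power[OF n, of d a]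
    let ?\<mu> = "Q_mean n d a"
    define t where "t = fact j ^ d / real n ^ ((d - 1) * j)"
    have int1: "integrable (sphere_unif n) (\<lambda>\<theta>. Q_poly n d a \<theta> - c)" using int[of c 1] by simp
    have "(c - ?\<mu>)\<^sup>2 = (expectation (\<lambda>\<theta>. Q_poly n d a \<theta> - c))\<^sup>2"
      using int[of 0 1] prob_space by (simp add: Q_mean_def power2_commute)
    also have "\<dots> \<le> expectation (\<lambda>\<theta>. (Q_poly n d a \<theta> - c)\<^sup>2)"
      using variance_positive[of "\<lambda>\<theta>. Q_poly n d a \<theta> - c"] variance_eq[OF int1 int[of c 2]] by simp
    also have "\<dots> \<le> K / real n ^ (d - 1)" using c[of 1] by simp
    finally have "((c - ?\<mu>)\<^sup>2) ^ j \<le> (K / real n ^ (d - 1)) ^ j" by (intro power_mono) auto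
    also have "\<dots> = K ^ j * 1 / real n ^ ((d - 1) * j)" by (simp add: power_divide power_mult)
    also have "\<dots> \<le> K ^ j * fact j ^ d / real n ^ ((d - 1) * j)"
      using K by (intro divide_right_mono mult_left_mono one_le_power) (auto simp: fact_ge_1)
    finally have shift: "(c - ?\<mu>) ^ (2 * j) \<le> K ^ j * t" by (simp add: power_mult t_def)
    have "(\<integral>\<theta>. (Q_poly n d a \<theta> - ?\<mu>) ^ (2 * j) \<partial>sphere_unif n)
      \<le> (\<integral>\<theta>. 4 ^ j * ((Q_poly n d a \<theta> - c) ^ (2 * j) + (c - ?\<mu>) ^ (2 * j)) \<partial>sphere_unif n)"
    proof (intro integral_mono int integrable_mult_right Bochner_Integration.integrable_add)
      show "(Q_poly n d a \<theta> - ?\<mu>) ^ (2 * j) \<le> 4 ^ j * ((Q_poly n d a \<theta> - c) ^ (2 * j) + (c - ?\<mu>) ^ (2 * j))" for \<theta>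
        using add_power_even_le[of "Q_poly n d a \<theta> - c" "c - ?\<mu>" j] by simp
    qed simp
    also have "\<dots> = 4 ^ j * ((\<integral>\<theta>. (Q_poly n d a \<theta> - c) ^ (2 * j) \<partial>sphere_unif n) + (c - ?\<mu>) ^ (2 * j))"
      using int[of c "2 * j"] prob_space by simp
    also have "\<dots> \<le> 4 ^ j * (K ^ j * t + K ^ j * t)"
      using c[OF j] shift by (intro mult_left_mono add_mono) (auto simp: t_def)
    also have "\<dots> = 4 ^ j * (2 * K ^ j) * t" by simp
    also have "\<dots> \<le> 4 ^ j * (2 * K) ^ j * t"
      using K two_mult_power_le[OF j, of K] by (intro mult_right_mono mult_left_mono) (auto simp: t_def)
    finally show "(\<integral>\<theta>. (Q_poly n d a \<theta> - ?\<mu>) ^ (2 * j) \<partial>sphere_unif n)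
       \<le> (4 * (2 * K)) ^ j * fact j ^ d / real n ^ ((d - 1) * j)"
      by (simp only: t_def power_mult_distrib times_divide_eq_right)
  qed
qed

theorem proposition6p1:
  fixes d :: nat
  assumes "d \<ge> 3"
  shows "(\<exists>c::real. c > 0 \<and>
            (\<forall>n\<ge>2. \<forall>a :: nat \<Rightarrow> real. (\<Sum>i=1..n. (a i)\<^sup>2) / real n = 1 \<longrightarrow>
               (\<integral>\<^sup>+\<theta>. ennreal (exp (c * real n powr ((real d - 1) / real d) *
                     \<bar>Q_poly n d a \<theta> - Q_mean n d a\<bar> powr (2 / real d))) \<partial>sphere_unif n) \<le> 2))
       \<and> (\<forall>a :: nat \<Rightarrow> nat \<Rightarrow> real.
            (\<forall>n\<ge>2. (\<Sum>i=1..n. (a n i)\<^sup>2) / real n = 1) \<longrightarrow>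
            stoch_bigo sphere_unif
              (\<lambda>n \<theta>. Q_poly n d (a n) \<theta> - Q_mean n d (a n))
              (\<lambda>n. real n powr (- ((real d - 1) / 2))))"
proof -
  \<comment> \<open>This scaling removes \<open>n\<close> from the moment bounds, so both claims
    reduce to statements about \<open>X\<close> uniform in \<open>n\<close> and
    \<open>a\<close>.\<close>
  define X where "X = (\<lambda>n a \<theta>. real n powr ((real d - 1) / 2) * (Q_poly n d a \<theta> - Q_mean n d a))"
  have d: "2 \<le> d" "1 \<le> d" using assms by auto
  obtain K where K: "K > 0" and *: "\<And>n a j. 1 \<le> n \<Longrightarrow> (\<Sum>i=1..n. (a i)\<^sup>2) = real n \<Longrightarrow> 1 \<le> j \<Longrightarrow>
     (\<integral>\<theta>. (Q_poly n d a \<theta> - Q_mean n d a) ^ (2 * j) \<partial>sphere_unif n) \<le> K ^ j * fact j ^ d / real n ^ ((d - 1) * j)"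
    using sphere_Q_poly_central_moment_le[OF d(1)] by blast
  have X_power: "X n a \<theta> ^ (2 * j) = real n ^ ((d - 1) * j) * (Q_poly n d a \<theta> - Q_mean n d a) ^ (2 * j)"
    if "1 \<le> n" for n a \<theta> j
  proof -
    have "(real n powr ((real d - 1) / 2)) ^ (2 * j) = real n powr (real ((d - 1) * j))"
      using that d by (simp add: powr_realpow[symmetric] powr_powr of_nat_diff)
    also have "\<dots> = real n ^ ((d - 1) * j)" using that by (intro powr_realpow) simp
    finally show ?thesis by (simp only: X_def power_mult_distrib)
  qed
  have X_int: "integrable (sphere_unif n) (\<lambda>\<theta>. X n a \<theta> ^ (2 * j))" if "1 \<le> n" for n a j
    unfolding X_power[OF that] by (intro integrable_mult_right integrable_sphere_Q_poly_power that)
  have X_mom: "(\<integral>\<theta>. X n a \<theta> ^ (2 * j) \<partial>sphere_unif n) \<le> K ^ j * fact j ^ d"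
    if "1 \<le> n" "(\<Sum>i=1..n. (a i)\<^sup>2) = real n" "1 \<le> j" for n a j
    using *[OF that] that(1) unfolding X_power[OF that(1)] by (simp add: pos_le_divide_eq mult.commute)
  have X_meas: "X n a \<in> borel_measurable (sphere_unif n)" for n a
    unfolding X_def by (intro measurable_sphere_unif) measurable
  \<comment> \<open>\<open>K\<close> was obtained before \<open>n\<close> and \<open>a\<close>, so
    \<open>c\<close> depends on \<open>d\<close> only.\<close>
  define c where "c = 1 / (3 * K powr (1 / real d))"
  have "(\<integral>\<^sup>+\<theta>. ennreal (exp (c * real n powr ((real d - 1) / real d) *
                     \<bar>Q_poly n d a \<theta> - Q_mean n d a\<bar> powr (2 / real d))) \<partial>sphere_unif n) \<le> 2"
    if n: "2 \<le> n" and a: "(\<Sum>i=1..n. (a i)\<^sup>2) / real n = 1" for n and a :: "nat \<Rightarrow> real"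
  proof -
    have n1: "1 \<le> n" using n by simp
    have a1: "(\<Sum>i=1..n. (a i)\<^sup>2) = real n" using a n by (simp add: divide_eq_1_iff)
    interpret prob_space "sphere_unif n" using n1 by (rule prob_space_sphere_unif)
    have "(real n powr ((real d - 1) / 2)) powr (2 / real d) = real n powr ((real d - 1) / real d)"
      unfolding powr_powr using d by (intro arg_cong[where f="(powr) (real n)"]) (simp add: field_simps)
    then have eq: "c * real n powr ((real d - 1) / real d) * \<bar>Q_poly n d a \<theta> - Q_mean n d a\<bar> powr (2 / real d)
        = c * \<bar>X n a \<theta>\<bar> powr (2 / real d)" for \<theta>
      by (simp add: X_def abs_mult powr_mult)
    show ?thesis
      unfolding eq unfolding c_def
      by (rule nn_integral_exp_powr_le_2[OF d(2) K X_meas X_int[OF n1] X_mom[OF n1 a1]])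
  qed
  moreover have "0 < c" using K by (simp add: c_def)
  moreover have "stoch_bigo sphere_unif (\<lambda>n \<theta>. Q_poly n d (a n) \<theta> - Q_mean n d (a n))
              (\<lambda>n. real n powr (- ((real d - 1) / 2)))"
    if a: "\<forall>n\<ge>2. (\<Sum>i=1..n. (a n i)\<^sup>2) / real n = 1" for a :: "nat \<Rightarrow> nat \<Rightarrow> real"
    unfolding stoch_bigo_def
  proof (intro allI impI)
    fix \<epsilon> :: real assume \<epsilon>: "\<epsilon> > 0"
    \<comment> \<open>Chosen so that Chebyshev's bound \<open>K / \<kappa>^2\<close> falls below
      \<open>\<epsilon>\<close>; the added 1 makes the inequality strict.\<close>
    define \<kappa> where "\<kappa> = sqrt (K / \<epsilon>) + 1"
    have \<kappa>: "0 < \<kappa>" using K \<epsilon> by (simp add: \<kappa>_def add_nonneg_pos)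
    have "(sqrt (K / \<epsilon>))\<^sup>2 < \<kappa>\<^sup>2" unfolding \<kappa>_def using K \<epsilon> by (intro power_strict_mono) auto
    then have K\<kappa>: "K / \<kappa>\<^sup>2 < \<epsilon>" using K \<epsilon> \<kappa> by (simp add: field_simps)
    have "measure (sphere_unif n) {\<theta> \<in> space (sphere_unif n).
        \<bar>(Q_poly n d (a n) \<theta> - Q_mean n d (a n)) / real n powr (- ((real d - 1) / 2))\<bar> > \<kappa>} < \<epsilon>"
      if n: "2 \<le> n" for n
    proof -
      have n1: "1 \<le> n" using n by simp
      have a1: "(\<Sum>i=1..n. (a n i)\<^sup>2) = real n" using a n by (simp add: divide_eq_1_iff)
      interpret prob_space "sphere_unif n" using n1 by (rule prob_space_sphere_unif)
      note X_meas[measurable]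
      have "measure (sphere_unif n) {\<theta> \<in> space (sphere_unif n).
          \<bar>(Q_poly n d (a n) \<theta> - Q_mean n d (a n)) / real n powr (- ((real d - 1) / 2))\<bar> > \<kappa>}
        \<le> measure (sphere_unif n) {\<theta> \<in> space (sphere_unif n). \<kappa>\<^sup>2 \<le> (X n (a n) \<theta>)\<^sup>2}"
      proof (intro finite_measure_mono subsetI)
        fix \<theta> assume "\<theta> \<in> {\<theta> \<in> space (sphere_unif n).
          \<bar>(Q_poly n d (a n) \<theta> - Q_mean n d (a n)) / real n powr (- ((real d - 1) / 2))\<bar> > \<kappa>}"
        moreover have "(Q_poly n d (a n) \<theta> - Q_mean n d (a n)) / real n powr (- ((real d - 1) / 2)) = X n (a n) \<theta>"
          unfolding X_def powr_minus by (simp only: divide_inverse inverse_inverse_eq mult.commute)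
        ultimately have "\<theta> \<in> space (sphere_unif n)" "\<kappa> \<le> \<bar>X n (a n) \<theta>\<bar>"
          by (simp_all only: mem_Collect_eq)  (simp_all only: less_imp_le)
        then show "\<theta> \<in> {\<theta> \<in> space (sphere_unif n). \<kappa>\<^sup>2 \<le> (X n (a n) \<theta>)\<^sup>2}"
          using \<kappa> power_mono[of \<kappa> "\<bar>X n (a n) \<theta>\<bar>" 2] by simp
      qed measurable
      \<comment> \<open>Chebyshev's inequality; the second moment is the case \<open>j = 1\<close>,
        bounded by \<open>K\<close> for every \<open>n \<ge> 2\<close>.\<close>
      also have "\<dots> \<le> (\<integral>\<theta>. (X n (a n) \<theta>)\<^sup>2 \<partial>sphere_unif n) / \<kappa>\<^sup>2"
        using X_int[OF n1, of "a n" 1] \<kappa> by (intro integral_Markov_inequality_measure[where A="{}"]) auto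
      also have "\<dots> \<le> K / \<kappa>\<^sup>2"
        using X_mom[OF n1 a1, of 1] by (intro divide_right_mono) auto
      finally show ?thesis using K\<kappa> by simp
    qed
    then have "\<forall>\<^sub>F n in sequentially. measure (sphere_unif n) {\<theta> \<in> space (sphere_unif n).
        \<bar>(Q_poly n d (a n) \<theta> - Q_mean n d (a n)) / real n powr (- ((real d - 1) / 2))\<bar> > \<kappa>} < \<epsilon>"
      by (rule eventually_sequentiallyI)
    with \<kappa> show "\<exists>K>0. \<forall>\<^sub>F n in sequentially. measure (sphere_unif n) {\<theta> \<in> space (sphere_unif n).
        \<bar>(Q_poly n d (a n) \<theta> - Q_mean n d (a n)) / real n powr (- ((real d - 1) / 2))\<bar> > K} < \<epsilon>"
      by blast
  qed
  ultimately show ?thesis by blast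
qed

end
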